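(* Let $k \geq 2$ be an integer such that $2k+1$ is prime, and let $w$ be the word $x_1^2[x_1^{-2}, x_2^{-1}]^k$ in the free group $F_2$ on $x_1,x_2$. Let $\zeta$ be a primitive $(2k+1)$-th root of unity. Let $p \neq 2k + 1$ be a prime of inertia degree $m > 1$ in $\mathbb{Q}(\zeta + \zeta^{-1})$ such that $\left(\frac{2}{p}\right) = -1$. Then the word map $(x,y) \mapsto w(x,y)$ is non-surjective on $\mathrm{PSL}_2(q)$ for all $q = p^n$ where $n$ is a positive integer not divisible by $2$ or by $m$.
   Context: Commutator convention: $[a,b] = a^{-1}b^{-1}ab$, so $[x_1^{-2},x_2^{-1}] = x_1^{2}x_2x_1^{-2}x_2^{-1}$. For a group $G$ and a word $w = w(x_1,x_2)\in F_2$, the word map on $G$ is the map $G\times G \to G$, $(x,y)\mapsto w(x,y)$, obtained by substituting $x$ for $x_1$ and $y$ for $x_2$; it is non-surjective on $G$ if its image is not all of $G$. The root of unity $\zeta$ is taken in $\mathbb{C}$. The inertia degree of $p$ in $\mathbb{Q}(\zeta+\zeta^{-1})$ is the degree over $\mathbb{F}_p$ of the residue field $\mathcal{O}/P$, where $\mathcal{O}$ is the ring of integers of $\mathbb{Q}(\zeta+\zeta^{-1})$ and $P$ is a prime ideal of $\mathcal{O}$ above $p$ (independent of the choice of $P$, as the extension of $\mathbb{Q}$ is Galois). $\left(\frac{2}{p}\right)=-1$ is the Legendre symbol condition: $p$ is odd and $2$ is not a square modulo $p$. $\mathrm{PSL}_2(q)=\mathrm{SL}_2(\mathbb{F}_q)/\{\pm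 I\}$. *)

theory Defs
  imports
    "HOL-Analysis.Analysis"
    "HOL-Algebra.Algebra"
    "HOL-Algebra.Algebraic_Closure_Type"
    "HOL-Number_Theory.Number_Theory"
begin

datatype gen = X1 | X2

text \<open>The letter \<open>(g, True)\<close> is the generator \<open>g\<close>, and \<open>(g, False)\<close> is its formal inverse.\<close>

type_synonym letter = "gen \<times> bool"

definition letter_inv :: "letter \<Rightarrow> letter" where
  "letter_inv a = (fst a, \<not> snd a)"

definition reduced :: "letter list \<Rightarrow> bool" where
  "reduced w \<longleftrightarrow> successively (\<lambda>a b. b \<noteq> letter_inv a) w"

fun cancel_cons :: "letter \<Rightarrow> letter list \<Rightarrow> letter list" where
  "cancel_cons a [] = [a]"
| "cancel_cons a (b # w) = (if b = letter_inv a then w else a # b # w)"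

definition reduce :: "letter list \<Rightarrow> letter list" where
  "reduce w = foldr cancel_cons w []"

definition F2 :: "letter list monoid" where
  "F2 = \<lparr>carrier = {w. reduced w}, mult = (\<lambda>u v. reduce (u @ v)), one = []\<rparr>"

definition x1 :: "letter list" where
  "x1 = [(X1, True)]"

definition x2 :: "letter list" where
  "x2 = [(X2, True)]"

definition commutator :: "('a, 'b) monoid_scheme \<Rightarrow> 'a \<Rightarrow> 'a \<Rightarrow> 'a" where
  "commutator G a b = inv\<^bsub>G\<^esub> a \<otimes>\<^bsub>G\<^esub> inv\<^bsub>G\<^esub> b \<otimes>\<^bsub>G\<^esub> a \<otimes>\<^bsub>G\<^esub> b"

definition letter_value :: "('a, 'b) monoid_scheme \<Rightarrow> 'a \<Rightarrow> 'a \<Rightarrow> letter \<Rightarrow> 'a" where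
  "letter_value G x y a =
    (let g = (case fst a of X1 \<Rightarrow> x | X2 \<Rightarrow> y) in if snd a then g else inv\<^bsub>G\<^esub> g)"

definition word_map :: "('a, 'b) monoid_scheme \<Rightarrow> letter list \<Rightarrow> 'a \<times> 'a \<Rightarrow> 'a" where
  "word_map G w = (\<lambda>(x, y). foldr (\<lambda>a g. letter_value G x y a \<otimes>\<^bsub>G\<^esub> g) w \<one>\<^bsub>G\<^esub>)"

definition surjective_word_map :: "('a, 'b) monoid_scheme \<Rightarrow> letter list \<Rightarrow> bool" where
  "surjective_word_map G w \<longleftrightarrow> word_map G w ` (carrier G \<times> carrier G) = carrier G"

lemma letter_inv_letter_inv [simp]: "letter_inv (letter_inv a) = a"
  by (simp add: letter_inv_def)

lemma reduced_Nil [simp]: "reduced []"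
  by (simp add: reduced_def)

lemma reduced_Cons: "reduced (a # w) \<Longrightarrow> reduced w"
  by (cases w) (auto simp: reduced_def)

lemma reduced_cancel_cons: "reduced w \<Longrightarrow> reduced (cancel_cons a w)"
  by (cases w) (auto simp: reduced_def successively_Cons)

lemma cancel_cons_letter_inv:
  assumes "reduced w"
  shows "cancel_cons a (cancel_cons (letter_inv a) w) = w"
  using assms by (cases w; cases "tl w") (auto simp: reduced_def)

lemma reduced_foldr: "reduced v \<Longrightarrow> reduced (foldr cancel_cons u v)"
  by (induction u) (auto intro: reduced_cancel_cons)

lemma foldr_cancel_reduced: "reduced w \<Longrightarrow> foldr cancel_cons w [] = w"
proof (induction w)
  case (Cons a w)
  then show ?case
    by (cases w) (auto simp: reduced_def)
qed auto

lemma mult_F2: "reduced v \<Longrightarrow> u \<otimes>\<^bsub>F2\<^esub> v = foldr cancel_cons u v"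
  by (simp add: F2_def reduce_def foldr_cancel_reduced)

lemma foldr_cancel_cons:
  assumes "reduced u" "reduced v"
  shows "foldr cancel_cons (cancel_cons a u) v = cancel_cons a (foldr cancel_cons u v)"
proof (cases u)
  case (Cons b u')
  show ?thesis
  proof (cases "b = letter_inv a")
    case True
    then show ?thesis
      using Cons assms cancel_cons_letter_inv reduced_foldr by simp
  qed (simp add: Cons)
qed simp

lemma foldr_cancel_foldr:
  assumes "reduced v" "reduced w"
  shows "foldr cancel_cons (foldr cancel_cons u v) w
    = foldr cancel_cons u (foldr cancel_cons v w)"
  by (induction u) (simp_all add: foldr_cancel_cons assms reduced_foldr)

lemma foldr_cancel_inverse:
  assumes "reduced v"
  shows "foldr cancel_cons (rev (map letter_inv w)) (foldr cancel_cons w v) = v"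
  using assms
proof (induction w)
  case (Cons a w)
  have "cancel_cons (letter_inv a) (cancel_cons a (foldr cancel_cons w v)) = foldr cancel_cons w v"
    using cancel_cons_letter_inv[of "foldr cancel_cons w v" "letter_inv a"] Cons.prems
    by (simp add: reduced_foldr)
  then show ?case
    using Cons by simp
qed simp

lemma reduced_inverse: "reduced w \<Longrightarrow> reduced (rev (map letter_inv w))"
  unfolding reduced_def successively_rev successively_map
  by (erule successively_mono) (auto simp: letter_inv_def)

lemma group_F2: "group F2"
proof (rule groupI)
  fix u v w assume "u \<in> carrier F2" "v \<in> carrier F2" "w \<in> carrier F2"
  then have red: "reduced u" "reduced v" "reduced w"
    by (simp_all add: F2_def)
  then show "u \<otimes>\<^bsub>F2\<^esub> v \<otimes>\<^bsub>F2\<^esub> w = u \<otimes>\<^bsub>F2\<^esub> (v \<otimes>\<^bsub>F2\<^esub> w)"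
    by (simp add: mult_F2 reduced_foldr foldr_cancel_foldr)
next
  fix u assume "u \<in> carrier F2"
  then have red: "reduced u"
    by (simp add: F2_def)
  have "rev (map letter_inv u) \<otimes>\<^bsub>F2\<^esub> u = \<one>\<^bsub>F2\<^esub>"
    using foldr_cancel_inverse[of "[]" u] red
    by (simp add: mult_F2 foldr_cancel_reduced) (simp add: F2_def)
  then show "\<exists>v\<in>carrier F2. v \<otimes>\<^bsub>F2\<^esub> u = \<one>\<^bsub>F2\<^esub>"
    using reduced_inverse[OF red] by (auto simp: F2_def)
qed (auto simp: F2_def reduce_def foldr_cancel_reduced simp del: foldr_append intro: reduced_foldr)

lemma (in group) word_map_closed:
  assumes "x \<in> carrier G" "y \<in> carrier G"
  shows "word_map G w (x, y) \<in> carrier G"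
  unfolding word_map_def
  by (induction w) (auto simp: letter_value_def Let_def assms split: gen.split)

lemma (in group) word_map_cancel_cons:
  assumes "x \<in> carrier G" "y \<in> carrier G"
  shows "word_map G (cancel_cons a w) (x, y) = letter_value G x y a \<otimes> word_map G w (x, y)"
proof (cases w)
  case (Cons b w')
  have val: "letter_value G x y c \<in> carrier G" for c
    by (auto simp: letter_value_def Let_def assms split: gen.split)
  have inv: "letter_value G x y a \<otimes> letter_value G x y (letter_inv a) = \<one>"
    by (auto simp: letter_value_def letter_inv_def Let_def assms split: gen.split)
  show ?thesis
    using Cons inv val word_map_closed[OF assms, of w']
    by (auto simp: word_map_def m_assoc[symmetric])
qed (simp add: word_map_def)

lemma (in group) word_map_hom:
  assumes "x \<in> carrier G" "y \<in> carrier G"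
  shows "(\<lambda>w. word_map G w (x, y)) \<in> hom F2 G"
proof (rule homI)
  fix u v assume "u \<in> carrier F2" "v \<in> carrier F2"
  then have "u \<otimes>\<^bsub>F2\<^esub> v = foldr cancel_cons u v"
    by (intro mult_F2) (simp add: F2_def)
  moreover have "word_map G (foldr cancel_cons u v) (x, y)
      = word_map G u (x, y) \<otimes> word_map G v (x, y)"
  proof (induction u)
    case Nil
    then show ?case
      using word_map_closed[OF assms, of v] by (simp add: word_map_def)
  next
    case (Cons a u)
    have "letter_value G x y a \<in> carrier G"
      by (auto simp: letter_value_def Let_def assms split: gen.split)
    moreover have "word_map G (a # u) (x, y) = letter_value G x y a \<otimes> word_map G u (x, y)"
      by (simp add: word_map_def)
    ultimately show ?case
      using Cons word_map_closed[OF assms]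
      by (simp add: word_map_cancel_cons[OF assms] m_assoc)
  qed
  ultimately show "word_map G (u \<otimes>\<^bsub>F2\<^esub> v) (x, y)
      = word_map G u (x, y) \<otimes> word_map G v (x, y)"
    by simp
qed (simp add: word_map_closed assms)

definition SL2 :: "('f::field^2^2) monoid" where
  "SL2 = \<lparr>carrier = {A. det A = 1}, mult = (**), one = mat 1\<rparr>"

definition PSL2 :: "('f::field^2^2) set monoid" where
  "PSL2 = SL2 Mod {mat 1, - mat 1}"

lemma group_SL2: "group (SL2 :: ('f::field^2^2) monoid)"
proof (rule groupI)
  fix A :: "'f^2^2" assume "A \<in> carrier SL2"
  then have d: "det A = 1"
    by (simp add: SL2_def)
  then obtain B where B: "B ** A = mat 1"
    by (metis invertible_det_nz invertible_def zero_neq_one)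
  then have "det B = 1"
    using d det_mul[of B A] by simp
  with B show "\<exists>B\<in>carrier SL2. B \<otimes>\<^bsub>SL2\<^esub> A = \<one>\<^bsub>SL2\<^esub>"
    by (auto simp: SL2_def)
qed (auto simp: SL2_def det_mul matrix_mul_assoc)

lemma normal_plus_minus_one: "{mat 1, - mat 1} \<lhd> (SL2 :: ('f::field^2^2) monoid)"
proof -
  interpret group "SL2 :: ('f^2^2) monoid"
    by (rule group_SL2)
  have neg: "- A = (- mat 1) ** A" "- A = A ** (- mat 1)" for A :: "'f^2^2"
    by (simp_all add: vec_eq_iff matrix_matrix_mult_def mat_def forall_2 sum_2)
  have sq: "(- mat 1) ** (- mat 1) = (mat 1 :: 'f^2^2)"
    by (metis minus_minus neg(1))
  have det: "det (- mat 1 :: 'f^2^2) = 1"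
    by (simp add: det_2 mat_def)
  have sub: "subgroup {mat 1, - mat 1} (SL2 :: ('f^2^2) monoid)"
  proof (rule subgroupI)
    fix A :: "'f^2^2" assume A: "A \<in> {mat 1, - mat 1}"
    then have "inv\<^bsub>SL2\<^esub> A = A"
      by (intro inv_equality) (auto simp: SL2_def sq det)
    with A show "inv\<^bsub>SL2\<^esub> A \<in> {mat 1, - mat 1}"
      by simp
  qed (auto simp: SL2_def det sq)
  show ?thesis
    unfolding normal_inv_iff
  proof (intro conjI ballI sub)
    fix A Z :: "'f^2^2" assume A: "A \<in> carrier SL2" and Z: "Z \<in> {mat 1, - mat 1}"
    then have "A \<otimes>\<^bsub>SL2\<^esub> Z = Z \<otimes>\<^bsub>SL2\<^esub> A" "Z \<in> carrier SL2"
      using neg[of A] det by (auto simp: SL2_def)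
    then have "A \<otimes>\<^bsub>SL2\<^esub> Z \<otimes>\<^bsub>SL2\<^esub> inv\<^bsub>SL2\<^esub> A = Z"
      using A by (simp add: m_assoc)
    with Z show "A \<otimes>\<^bsub>SL2\<^esub> Z \<otimes>\<^bsub>SL2\<^esub> inv\<^bsub>SL2\<^esub> A \<in> {mat 1, - mat 1}"
      by simp
  qed
qed

lemma group_PSL2: "group (PSL2 :: ('f::field^2^2) set monoid)"
  unfolding PSL2_def by (rule normal.factorgroup_is_group[OF normal_plus_minus_one])

definition primitive_root_of_unity :: "nat \<Rightarrow> complex \<Rightarrow> bool" where
  "primitive_root_of_unity N z \<longleftrightarrow> z ^ N = 1 \<and> (\<forall>j. 0 < j \<and> j < N \<longrightarrow> z ^ j \<noteq> 1)"

text \<open>Since the prime field \<open>\<rat>\<close> lies in every subfield of \<open>\<complex>\<close>, \<open>adjoin_rat S\<close> is \<open>\<rat>(S)\<close>.\<close>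

definition adjoin_rat :: "complex set \<Rightarrow> complex set" where
  "adjoin_rat S = generate_field ring_of_type_algebra S"

definition ring_of_integers :: "complex set \<Rightarrow> complex ring" where
  "ring_of_integers K = ring_of_type_algebra \<lparr>carrier := {x \<in> K. algebraic_int x}\<rparr>"

definition prime_above :: "complex set \<Rightarrow> nat \<Rightarrow> complex set \<Rightarrow> bool" where
  "prime_above K p P \<longleftrightarrow>
    primeideal P (ring_of_integers K) \<and> P \<inter> \<int> = range (\<lambda>z. of_int (int p * z))"

text \<open>The copy of \<open>\<int>/p\<int>\<close> inside the residue field at \<open>P\<close>: the image of \<open>\<int>\<close>.\<close>

definition residue_prime_field :: "complex set \<Rightarrow> complex set \<Rightarrow> complex set set" where
  "residue_prime_field K P = range (\<lambda>z. P +>\<^bsub>ring_of_integers K\<^esub> of_int z)"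

text \<open>
  \<open>inertia_degree K p m\<close>: the residue field at some prime above \<open>p\<close> has dimension \<open>m\<close> over
  \<open>\<int>/p\<int>\<close>. When \<open>K\<close> is Galois over \<open>\<rat>\<close> the choice of the prime is immaterial.
\<close>

definition inertia_degree :: "complex set \<Rightarrow> nat \<Rightarrow> nat \<Rightarrow> bool" where
  "inertia_degree K p m \<longleftrightarrow>
    (\<exists>P. prime_above K p P \<and>
      ring.dimension (ring_of_integers K Quot P) m
        (residue_prime_field K P) (carrier (ring_of_integers K Quot P)))"

end

theory Submission
  imports Defs
begin

text \<open>
  Every value of the word on \<open>SL2\<close> has nonzero trace, while \<open>PSL2\<close> contains the class of a matrix
  of trace zero; this class is therefore missed.

  Put \<open>S = x\<^sup>2\<close> and \<open>T = y S\<^sup>-\<^sup>1 y\<^sup>-\<^sup>1\<close>. The word takes the value \<open>S (S T)\<^sup>k\<close>, and \<open>S\<close> and \<open>T\<close> have the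
  same trace, so Cayley-Hamilton gives \<open>tr (S (S T)\<^sup>k) = \<plusminus> tr S \<cdot> \<psi>\<^sub>k (- tr (S T))\<close>
  (\<open>trace_mult_power\<close>), where \<open>\<psi>\<^sub>k (\<eta> + \<eta>\<^sup>-\<^sup>1) = \<eta>\<^sup>-\<^sup>k (1 + \<eta> + \<dots> + \<eta>\<^sup>2\<^sup>k)\<close>. The first factor is
  \<open>(tr x)\<^sup>2 - 2\<close>, which has no zero because \<open>2\<close> is not a square modulo \<open>p\<close> and the field has odd
  degree over its prime field (\<open>two_nonsquare\<close>).

  Write \<open>N = 2k + 1\<close> and \<open>q = p\<^sup>n\<close>. A zero \<open>\<eta> + \<eta>\<^sup>-\<^sup>1\<close> of \<open>\<psi>\<^sub>k\<close> in the field with \<open>q\<close> elements comes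
  from an \<open>\<eta>\<close> of order \<open>N\<close> which the \<open>q\<close>-th power map sends to \<open>\<eta>\<close> or \<open>\<eta>\<^sup>-\<^sup>1\<close>; hence
  \<open>q \<equiv> \<plusminus>1 (mod N)\<close> (\<open>psi_zero_imp_cong\<close>). It remains to see that this congruence forces the inertia
  degree \<open>m\<close> to divide \<open>n\<close>. With \<open>\<beta> = \<zeta> + \<zeta>\<^sup>-\<^sup>1\<close>, the congruence says \<open>\<zeta>\<^sup>q + \<zeta>\<^sup>-\<^sup>q = \<beta>\<close>, so the \<open>q\<close>-th power
  map is the identity on \<open>\<int>[\<beta>]\<close> modulo \<open>p\<close> (\<open>frobenius_fixes_cyclotomic_trace\<close>,
  \<open>frobenius_fixes_int_adjoin\<close>). In particular \<open>\<int>[\<beta>]\<close> has no nilpotent elements modulo \<open>p\<close>, which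
  makes it integrally closed at \<open>p\<close> (\<open>algebraic_int_in_int_adjoin\<close>). Therefore every algebraic integer of
  \<open>\<rat>(\<beta>)\<close> has a multiple in \<open>\<int>[\<beta>]\<close> by an integer prime to \<open>p\<close>, and the \<open>q\<close>-th power map is the
  identity on the whole residue field. That field has \<open>p\<^sup>m\<close> elements and a cyclic group of units, so
  \<open>p\<^sup>m - 1\<close> divides \<open>p\<^sup>n - 1\<close>, that is, \<open>m\<close> divides \<open>n\<close> (\<open>inertia_degree_dvd\<close>).
\<close>

section \<open>The trace polynomials\<close>

text \<open>
  In terms of Chebyshev polynomials \<open>U\<close> of the second kind, normalised so that
  \<open>U\<^sub>k (\<eta> + \<eta>\<^sup>-\<^sup>1) = (\<eta>\<^sup>k\<^sup>+\<^sup>1 - \<eta>\<^sup>-\<^sup>k\<^sup>-\<^sup>1) / (\<eta> - \<eta>\<^sup>-\<^sup>1)\<close>, this is \<open>U\<^sub>k + U\<^sub>k\<^sub>-\<^sub>1\<close>. The recursion makes sense in every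
  commutative ring; at a polynomial argument it yields \<open>\<psi>\<^sub>k\<close> itself as a polynomial.
\<close>

fun psi :: "nat \<Rightarrow> 'a::comm_ring_1 \<Rightarrow> 'a" where
  "psi 0 t = 1"
| "psi (Suc 0) t = t + 1"
| "psi (Suc (Suc k)) t = t * psi (Suc k) t - psi k t"

lemma psi_closed_form:
  fixes \<eta> :: "'a::field"
  assumes "\<eta> \<noteq> 0"
  shows "psi k (\<eta> + inverse \<eta>) * \<eta> ^ k * (\<eta> - 1) = \<eta> ^ (2 * k + 1) - 1"
proof (induction k rule: induct_nat_012)
  case 1
  show ?case using assms by (simp add: field_simps power2_eq_square power3_eq_cube)
next
  case (ge2 k)
  have t: "(\<eta> + inverse \<eta>) * \<eta> = \<eta>\<^sup>2 + 1"
    using assms by (simp add: field_simps power2_eq_square)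
  have "psi (Suc (Suc k)) (\<eta> + inverse \<eta>) * \<eta> ^ Suc (Suc k) * (\<eta> - 1)
      = ((\<eta> + inverse \<eta>) * \<eta>) * (psi (Suc k) (\<eta> + inverse \<eta>) * \<eta> ^ Suc k * (\<eta> - 1))
        - \<eta>\<^sup>2 * (psi k (\<eta> + inverse \<eta>) * \<eta> ^ k * (\<eta> - 1))"
    by (simp add: algebra_simps power2_eq_square)
  also have "\<dots> = \<eta> ^ (2 * Suc (Suc k) + 1) - 1"
    unfolding ge2 t by (simp add: algebra_simps power2_eq_square)
  finally show ?case .
qed simp

text \<open>
  This is the case \<open>\<eta> = 1\<close>, where the closed form degenerates to \<open>0 = 0\<close>. It keeps \<open>\<eta> = 1\<close> from
  producing a zero of \<open>\<psi>\<^sub>k\<close> when the characteristic does not divide \<open>2k + 1\<close>.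
\<close>

lemma psi_two: "psi k 2 = of_nat (2 * k + 1)"
proof (induction k rule: induct_nat_012)
  case (ge2 k)
  show ?case unfolding psi.simps ge2 by (simp add: algebra_simps)
qed simp_all

lemma poly_psi: "poly (psi k f) x = psi k (poly f x)"
  by (induction k rule: induct_nat_012) simp_all

lemma psi_X_degree:
  "Polynomial.degree (psi k [:0, 1::'a::idom:]) = k \<and> Polynomial.coeff (psi k [:0, 1::'a:]) k = 1"
proof (induction k rule: induct_nat_012)
  case (ge2 k)
  let ?f = "psi (Suc k) [:0, 1::'a:]" and ?g = "psi k [:0, 1::'a:]"
  have "?f \<noteq> 0" using ge2(2) by auto
  then have "Polynomial.degree ([:0, 1:] * ?f) = Suc (Suc k)"
    using ge2(2) by simp
  then have "Polynomial.degree ([:0, 1:] * ?f - ?g) = Suc (Suc k)"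
    using ge2(1) degree_add_eq_left[of "- ?g" "[:0, 1:] * ?f"] by simp
  moreover have "Polynomial.coeff ([:0, 1:] * ?f - ?g) (Suc (Suc k)) = 1"
    using ge2 by (simp add: coeff_eq_0)
  ultimately show ?case by simp
qed (simp_all add: one_pCons)

text \<open>
  The polynomial \<open>\<psi>\<^sub>k\<close> is monic with integer coefficients.
\<close>

lemma algebraic_int_psi_root:
  fixes t :: "'a::field"
  assumes "psi k t = 0"
  shows "algebraic_int t"
proof (rule algebraic_int.intros)
  let ?f = "psi k [:0, 1::'a:]"
  show "Polynomial.lead_coeff ?f = 1" using psi_X_degree[of k, where 'a = 'a] by simp
  show "poly ?f t = 0" using assms by (simp add: poly_psi)
  have "\<forall>i. Polynomial.coeff (psi j [:0, 1::'a:]) i \<in> \<int>" for j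
  proof (induction j rule: induct_nat_012)
    case (ge2 j)
    then show ?case by (auto simp: coeff_pCons intro!: Ints_diff split: nat.split)
  qed (auto simp: coeff_pCons coeff_1 split: nat.split)
  then show "\<forall>i. Polynomial.coeff ?f i \<in> \<int>" .
qed

section \<open>Zeros of the trace factors in finite fields\<close>

lemma CHAR_of_card:
  assumes "CARD('f::{field, finite}) = p ^ n" "Factorial_Ring.prime p"
  shows "CHAR('f) = p"
proof -
  have "CHAR('f) > 0"
    by (simp add: finite_imp_CHAR_pos)
  then have "Factorial_Ring.prime CHAR('f)"
    by (rule prime_CHAR_semidom)
  moreover have "CHAR('f) dvd p ^ n"
    using CHAR_dvd_CARD[where 'a='f] assms by simp
  ultimately show ?thesis
    using assms(2) by (metis prime_dvd_power primes_dvd_imp_eq)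
qed

lemma nat_pow_type_algebra [simp]: "x [^]\<^bsub>ring_of_type_algebra\<^esub> (n::nat) = x ^ n"
  by (induction n) (simp_all add: ring_of_type_algebra_def nat_pow_def power_commutes)

lemma power_card_eq_self:
  fixes x :: "'f::{field, finite}"
  shows "x ^ CARD('f) = x"
proof (cases "x = 0")
  case False
  define R where "R = (ring_of_type_algebra :: 'f ring)"
  interpret field R unfolding R_def by (rule field_from_type_algebra)
  interpret M: group "Multiplicative_Group.mult_of R" by (rule field_mult_group)
  have "x \<in> carrier (Multiplicative_Group.mult_of R)" "order (Multiplicative_Group.mult_of R) = CARD('f) - 1"
    using False by (simp_all add: R_def ring_of_type_algebra_def order_def card_Diff_singleton)
  then have "x ^ (CARD('f) - 1) = 1"
    using M.pow_order_eq_1[of x] unfolding Multiplicative_Group.nat_pow_mult_of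
    by (simp add: R_def) (simp add: ring_of_type_algebra_def)
  then show ?thesis
    using power_Suc[of x "CARD('f) - 1"] by simp
qed (simp add: finite_UNIV_card_ge_0)

text \<open>
  In the algebraic closure write \<open>t = \<eta> + \<eta>\<^sup>-\<^sup>1\<close>. The closed form makes \<open>\<eta>\<close> a nontrivial \<open>(2k+1)\<close>-th
  root of unity, hence of exact order \<open>2k + 1\<close>. As \<open>t\<close> lies in the field with \<open>q = p\<^sup>n\<close>
  elements, \<open>\<eta>\<^sup>q\<close> is again a root of \<open>Z\<^sup>2 - t Z + 1\<close>, so it is \<open>\<eta>\<close> or \<open>\<eta>\<^sup>-\<^sup>1\<close>.
\<close>

lemma psi_zero_imp_cong:
  fixes t :: "'f::{field, finite}"
  assumes "CARD('f) = p ^ n" "Factorial_Ring.prime p"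
    and N: "Factorial_Ring.prime (2 * k + 1)" "p \<noteq> 2 * k + 1"
    and psi: "psi k t = 0"
  shows "[p ^ n = 1] (mod (2 * k + 1)) \<or> [p ^ n + 1 = 0] (mod (2 * k + 1))"
proof -
  define q where "q = p ^ n"
  let ?N = "2 * k + 1"
  have char: "CHAR('f alg_closure) = p"
    using CHAR_of_card[OF assms(1,2)] by simp
  define T where "T = to_ac t"
  have psi_T: "psi j T = to_ac (psi j t)" for j
    by (induction j rule: induct_nat_012) (simp_all add: T_def)
  have "Polynomial.degree [:1, - T, 1:] > 0" by simp
  from alg_closed_imp_poly_has_root[OF this] obtain \<eta> where "poly [:1, - T, 1:] \<eta> = 0" by blast
  then have \<eta>: "T * \<eta> = 1 + \<eta> * \<eta>" by (simp add: algebra_simps)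
  then have nz: "\<eta> \<noteq> 0" by auto
  have "T * \<eta> = (\<eta> + inverse \<eta>) * \<eta>"
    using \<eta> nz by (simp add: algebra_simps)
  then have T: "T = \<eta> + inverse \<eta>" using nz by (simp only: mult_cancel_right) simp
  have pow: "\<eta> ^ ?N = 1"
    using psi_closed_form[OF nz, of k] psi_T[of k] psi T by simp
  have "\<eta> \<noteq> 1"
  proof
    assume "\<eta> = 1"
    then have "T = 2" using T by simp
    then have "(of_nat ?N :: 'f alg_closure) = 0"
      using psi_T[of k] psi psi_two[of k, where 'a = "'f alg_closure"] by simp
    then have "p dvd ?N" unfolding of_nat_eq_0_iff_char_dvd char .
    then show False using assms(2) N primes_dvd_imp_eq by blast
  qed
  have ord: "?N dvd j" if "\<eta> ^ j = 1" for j
  proof (rule ccontr)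
    assume "\<not> ?N dvd j"
    then have "coprime j ?N" using N(1) prime_imp_coprime coprime_commute by blast
    moreover have "?N \<noteq> 1" using N(1) not_prime_1 by metis
    ultimately obtain a b where "j * a = ?N * b + 1"
      using coprime_bezout_strong by blast
    then have "(\<eta> ^ j) ^ a = (\<eta> ^ ?N) ^ b * \<eta>"
      unfolding power_mult[symmetric] by (simp only: power_add power_one_right)
    then have "1 = \<eta>" using that pow by simp
    then show False using \<open>\<eta> \<noteq> 1\<close> by simp
  qed
  have dream: "(x + y) ^ q = x ^ q + y ^ q" for x y :: "'f alg_closure"
    using freshmans_dream'[where 'a = "'f alg_closure" and m = q and n = n] char assms(2)
    by (simp add: q_def)
  have "T ^ q = T"
    unfolding T_def q_def to_ac_power[symmetric] using power_card_eq_self[of t] assms(1) by simp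
  have "q > 0" unfolding q_def using assms(2) prime_gt_0_nat by simp
  have "T * \<eta> ^ q = (T * \<eta>) ^ q" by (simp add: power_mult_distrib \<open>T ^ q = T\<close>)
  also have "\<dots> = 1 + \<eta> ^ q * \<eta> ^ q" unfolding \<eta> dream by (simp add: power_mult_distrib)
  finally have "T * \<eta> ^ q = 1 + \<eta> ^ q * \<eta> ^ q" .
  moreover have "(\<eta> ^ q - \<eta>) * (\<eta> ^ q * \<eta> - 1)
      = \<eta> * (1 + \<eta> ^ q * \<eta> ^ q - T * \<eta> ^ q) + (T * \<eta> - (1 + \<eta> * \<eta>)) * \<eta> ^ q"
    by (simp add: algebra_simps)
  ultimately have "(\<eta> ^ q - \<eta>) * (\<eta> ^ q * \<eta> - 1) = 0" using \<eta> by simp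
  then consider "\<eta> ^ q = \<eta>" | "\<eta> ^ q * \<eta> = 1" by auto
  then show ?thesis
  proof cases
    case 1
    then have "\<eta> ^ (q - 1) = 1"
      using power_minus_mult[OF \<open>q > 0\<close>, of \<eta>] nz by simp
    from ord[OF this] show ?thesis
      using \<open>q > 0\<close> by (auto simp: cong_altdef_nat q_def)
  next
    case 2
    then have "\<eta> ^ (q + 1) = 1" by (simp add: mult.commute)
    from ord[OF this] show ?thesis by (simp add: cong_0_iff q_def)
  qed
qed

text \<open>
  Euler's criterion turns a square root \<open>s\<close> of \<open>2\<close> into \<open>s\<^sup>p = - s\<close>. Iterating an odd number \<open>n\<close> of
  times gives \<open>s = - s\<close>, because the power with exponent \<open>p\<^sup>n\<close> is \<open>s\<close> itself.
\<close>

lemma two_nonsquare: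
  fixes s :: "'f::{field, finite}"
  assumes "CARD('f) = p ^ n" "Factorial_Ring.prime p" "odd n" "Legendre 2 (int p) = - 1"
  shows "s\<^sup>2 \<noteq> 2"
proof
  assume s: "s\<^sup>2 = 2"
  have p2: "p \<noteq> 2" using assms(4) by (auto simp: Legendre_def cong_0_iff split: if_splits)
  then have "odd p" using assms(2) primes_dvd_imp_eq two_is_prime_nat by blast
  have "2 < p" using p2 prime_ge_2_nat[OF assms(2)] by simp
  have char: "CHAR('f) = p" using CHAR_of_card[OF assms(1,2)] .
  have "[Legendre 2 (int p) = 2 ^ ((p - 1) div 2)] (mod int p)"
    using euler_criterion[of p 2] \<open>2 < p\<close> assms(2) by simp
  then have "(of_int (- 1) :: 'f) = of_int (2 ^ ((p - 1) div 2))"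
    unfolding of_int_eq_iff_cong_CHAR char assms(4) by simp
  then have "(2::'f) ^ ((p - 1) div 2) = - 1" by simp
  moreover obtain r where "p = 2 * r + 1" using \<open>odd p\<close> by (elim oddE)
  ultimately have "s ^ (p - 1) = - 1" by (simp add: power_mult s)
  then have sp: "s ^ p = - s"
    using \<open>2 < p\<close> power_Suc[of s "p - 1"] by simp
  have "s ^ (p ^ j) = (- 1) ^ j * s" for j
  proof (induction j)
    case (Suc j)
    have "s ^ (p ^ Suc j) = (s ^ (p ^ j)) ^ p" by (simp add: power_mult[symmetric] mult.commute)
    also have "\<dots> = ((- 1) ^ p) ^ j * s ^ p"
      unfolding Suc by (simp add: power_mult_distrib power_mult[symmetric] mult.commute)
    finally show ?case using sp \<open>odd p\<close> by simp
  qed simp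
  from this[of n] have "s = - s"
    using power_card_eq_self[of s] assms by simp
  then have "2 * s = 0" unfolding mult_2 by (rule eq_neg_iff_add_eq_0[THEN iffD1])
  then have "2 * s\<^sup>2 = 0" by (simp add: power2_eq_square)
  then have "(of_nat 4 :: 'f) = 0" using s by simp
  then have "p dvd 4" unfolding of_nat_eq_0_iff_char_dvd char .
  then have "p dvd 2 ^ 2" by simp
  then have "p dvd 2" using assms(2) prime_dvd_power by blast
  then show False using \<open>2 < p\<close> by (auto dest: dvd_imp_le)
qed

section \<open>Traces of word values in SL2\<close>

text \<open>
  The Cayley-Hamilton relation \<open>C\<^sup>2 = tr C \<cdot> C - det C\<close>, multiplied by \<open>A\<close> and traced: the form in which
  it produces linear recurrences for traces of powers.
\<close>

lemma trace_mult_square: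
  fixes A C :: "'f::comm_ring_1^2^2"
  shows "trace (A ** (C ** C)) = trace C * trace (A ** C) - det C * trace A"
  by (simp add: trace_def det_2 sum_2 matrix_matrix_mult_def algebra_simps)

lemma trace_SL2_inv:
  assumes "A \<in> carrier (SL2 :: ('f::field^2^2) monoid)"
  shows "trace (inv\<^bsub>SL2\<^esub> A) = trace A"
proof -
  interpret group "SL2 :: ('f^2^2) monoid" by (rule group_SL2)
  let ?B = "inv\<^bsub>SL2\<^esub> A"
  have "?B ** A = mat 1" "det A = 1"
    using l_inv[OF assms] assms by (simp_all add: SL2_def)
  moreover have "?B ** (A ** A) = A"
    using calculation(1) by (simp add: matrix_mul_assoc)
  ultimately have "trace A = trace A * trace (mat 1 :: 'f^2^2) - trace ?B"
    using trace_mult_square[of ?B A] by simp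
  then show ?thesis by (simp add: trace_def mat_def sum_2 algebra_simps)
qed

text \<open>
  Both sides satisfy the recurrence \<open>u\<^sub>k\<^sub>+\<^sub>2 = c u\<^sub>k\<^sub>+\<^sub>1 - u\<^sub>k\<close> with \<open>c = tr (A B)\<close>. The equality of the
  traces enters at \<open>k = 1\<close>, where \<open>tr (A\<^sup>2 B) = tr A \<cdot> c - tr B\<close> factors as \<open>tr A \<cdot> (c - 1)\<close>.
\<close>

lemma trace_mult_power:
  fixes A B :: "'f::field^2^2"
  assumes "A \<in> carrier SL2" "B \<in> carrier SL2" and ab: "trace A = trace B"
  shows "trace (A \<otimes>\<^bsub>SL2\<^esub> (A \<otimes>\<^bsub>SL2\<^esub> B) [^]\<^bsub>SL2\<^esub> k) = trace A * ((- 1) ^ k * psi k (- trace (A ** B)))"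
proof -
  interpret group "SL2 :: ('f^2^2) monoid" by (rule group_SL2)
  have SL2: "x \<otimes>\<^bsub>SL2\<^esub> y = x ** y" "\<one>\<^bsub>SL2\<^esub> = mat 1" for x y :: "'f^2^2"
    by (simp_all add: SL2_def)
  have det: "det A = 1" "det B = 1" "det (A ** B) = 1"
    using assms by (simp_all add: SL2_def det_mul)
  show ?thesis
  proof (induction k rule: induct_nat_012)
    case 0
    then show ?case by (simp add: SL2)
  next
    case 1
    have "trace (A ** (A ** B)) = trace (B ** (A ** A))"
      unfolding matrix_mul_assoc[of A A B] by (rule trace_mul_sym)
    also have "\<dots> = trace A * trace (A ** B) - trace A"
      unfolding trace_mult_square det ab[symmetric] by (simp add: trace_mul_sym[of B A])
    finally show ?case by (simp add: SL2 algebra_simps)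
  next
    case (ge2 k)
    define P where "P = (A ** B) [^]\<^bsub>SL2\<^esub> k"
    have "A ** (P ** (A ** B) ** (A ** B)) = (A ** P) ** ((A ** B) ** (A ** B))"
      by (simp only: matrix_mul_assoc)
    moreover have "A ** (P ** (A ** B)) = A ** P ** (A ** B)"
      by (simp only: matrix_mul_assoc)
    ultimately have "trace (A ** (P ** (A ** B) ** (A ** B)))
        = trace (A ** B) * trace (A ** (P ** (A ** B))) - trace (A ** P)"
      by (simp only: trace_mult_square det mult_1)
    then show ?case
      using ge2 unfolding nat_pow_Suc SL2 P_def[symmetric] psi.simps
      by (simp add: algebra_simps)
  qed
qed

context group begin

lemma word_map_x1 [simp]: "x \<in> carrier G \<Longrightarrow> word_map G x1 (x, y) = x"
  and word_map_x2 [simp]: "y \<in> carrier G \<Longrightarrow> word_map G x2 (x, y) = y"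
  by (simp_all add: word_map_def x1_def x2_def letter_value_def)

lemma word_map_eval:
  fixes k :: nat
  assumes "x \<in> carrier G" "y \<in> carrier G"
  shows "word_map G ((x1 [^]\<^bsub>F2\<^esub> (2::nat)) \<otimes>\<^bsub>F2\<^esub>
      (commutator F2 (x1 [^]\<^bsub>F2\<^esub> (-2::int)) (x2 [^]\<^bsub>F2\<^esub> (-1::int))) [^]\<^bsub>F2\<^esub> k) (x, y)
    = x [^] (2::nat) \<otimes> (x [^] (2::nat) \<otimes> (y \<otimes> inv (x [^] (2::nat)) \<otimes> inv y)) [^] k"
proof -
  define h where "h = (\<lambda>w. word_map G w (x, y))"
  interpret F: group F2 by (rule group_F2)
  interpret h: group_hom F2 G h
    using word_map_hom[OF assms] by unfold_locales (simp add: h_def)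
  have X: "x1 \<in> carrier F2" "x2 \<in> carrier F2"
    by (simp_all add: F2_def x1_def x2_def reduced_def)
  have hX: "h x1 = x" "h x2 = y" using assms by (simp_all add: h_def)
  have m2: "x1 [^]\<^bsub>F2\<^esub> (-2::int) = inv\<^bsub>F2\<^esub> (x1 [^]\<^bsub>F2\<^esub> (2::nat))"
    using X F.int_pow_neg[of x1 2] int_pow_int[of F2 x1 2] by simp
  have m1: "x2 [^]\<^bsub>F2\<^esub> (-1::int) = inv\<^bsub>F2\<^esub> x2"
    using X by (simp add: F.int_pow_neg)
  have "h ((x1 [^]\<^bsub>F2\<^esub> (2::nat)) \<otimes>\<^bsub>F2\<^esub>
      (commutator F2 (x1 [^]\<^bsub>F2\<^esub> (-2::int)) (x2 [^]\<^bsub>F2\<^esub> (-1::int))) [^]\<^bsub>F2\<^esub> k)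
    = x [^] (2::nat) \<otimes> (x [^] (2::nat) \<otimes> y \<otimes> inv (x [^] (2::nat)) \<otimes> inv y) [^] k"
    unfolding commutator_def m1 m2 using X by (simp add: hX h.hom_nat_pow)
  then show ?thesis using assms by (simp add: h_def m_assoc)
qed

end

lemma (in group_hom) word_map_commute:
  assumes "x \<in> carrier G" "y \<in> carrier G"
  shows "word_map H w (h x, h y) = h (word_map G w (x, y))"
proof (induction w)
  case (Cons a w)
  have "word_map H (a # w) (h x, h y) = letter_value H (h x) (h y) a \<otimes>\<^bsub>H\<^esub> word_map H w (h x, h y)"
    "word_map G (a # w) (x, y) = letter_value G x y a \<otimes> word_map G w (x, y)"
    by (simp_all add: word_map_def)
  moreover have "letter_value H (h x) (h y) a = h (letter_value G x y a)"
    "letter_value G x y a \<in> carrier G"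
    using assms by (auto simp: letter_value_def Let_def split: gen.split)
  ultimately show ?case using Cons G.word_map_closed[OF assms] by simp
qed (simp add: word_map_def)

text \<open>
  Modulo \<open>\<plusminus>1\<close> the trace is defined up to sign, so the vanishing of the trace is a well defined
  property of an element of \<open>PSL2\<close>, and some element has it.
\<close>

lemma not_surjective_if_trace_nonzero:
  assumes nz: "\<And>A B :: 'f::field^2^2. A \<in> carrier SL2 \<Longrightarrow> B \<in> carrier SL2
      \<Longrightarrow> trace (word_map SL2 w (A, B)) \<noteq> 0"
  shows "\<not> surjective_word_map (PSL2 :: ('f^2^2) set monoid) w"
proof
  let ?S = "SL2 :: ('f^2^2) monoid" and ?Z = "{mat 1, - mat 1 :: 'f^2^2}"
  define \<pi> where "\<pi> = (\<lambda>A. ?Z #>\<^bsub>?S\<^esub> A)"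
  interpret N: normal ?Z ?S by (rule normal_plus_minus_one)
  interpret P: group "PSL2 :: ('f^2^2) set monoid" by (rule group_PSL2)
  interpret \<pi>: group_hom ?S PSL2 \<pi>
    using N.r_coset_hom_Mod by unfold_locales (simp add: \<pi>_def PSL2_def)
  have \<pi>: "\<pi> A = {A, - A}" for A
    by (auto simp: \<pi>_def r_coset_def SL2_def vec_eq_iff matrix_matrix_mult_def mat_def forall_2 sum_2)
  \<comment> \<open>A rotation by a right angle, with determinant 1 and trace 0.\<close>
  define M :: "'f^2^2" where "M = (\<chi> i j. if i = j then 0 else if i = 1 then 1 else - 1)"
  have "M \<in> carrier ?S" by (simp add: SL2_def det_2 M_def)
  assume "surjective_word_map (PSL2 :: ('f^2^2) set monoid) w"
  then have "\<pi> M \<in> word_map PSL2 w ` (carrier PSL2 \<times> carrier PSL2)"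
    using \<pi>.hom_closed[OF \<open>M \<in> carrier ?S\<close>] by (simp add: surjective_word_map_def)
  then obtain x y where xy: "x \<in> carrier PSL2" "y \<in> carrier PSL2" "\<pi> M = word_map PSL2 w (x, y)"
    by auto
  moreover have "carrier PSL2 = \<pi> ` carrier ?S"
    by (auto simp: PSL2_def FactGroup_def RCOSETS_def \<pi>_def)
  ultimately obtain A B where AB: "A \<in> carrier ?S" "B \<in> carrier ?S" "x = \<pi> A" "y = \<pi> B"
    by auto
  have "word_map ?S w (A, B) \<in> \<pi> M"
    using xy(3) \<pi>.word_map_commute[OF AB(1,2), of w] unfolding AB(3,4) by (simp add: \<pi>)
  then have "trace (word_map ?S w (A, B)) = 0"
    by (auto simp: \<pi> M_def trace_def sum_2)
  with nz[OF AB(1,2)] show False by simp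
qed

section \<open>The q-th power map on a monogenic order\<close>

text \<open>
  The subring \<open>\<int>[\<beta>]\<close>. Defining it by closure rather than as a set of values of polynomials lets
  congruences be checked on the generators only.
\<close>

inductive_set int_adjoin :: "'a::comm_ring_1 \<Rightarrow> 'a set" for \<beta> where
  one: "1 \<in> int_adjoin \<beta>"
| gen: "\<beta> \<in> int_adjoin \<beta>"
| uminus: "x \<in> int_adjoin \<beta> \<Longrightarrow> - x \<in> int_adjoin \<beta>"
| add: "x \<in> int_adjoin \<beta> \<Longrightarrow> y \<in> int_adjoin \<beta> \<Longrightarrow> x + y \<in> int_adjoin \<beta>"
| mult: "x \<in> int_adjoin \<beta> \<Longrightarrow> y \<in> int_adjoin \<beta> \<Longrightarrow> x * y \<in> int_adjoin \<beta>"

lemma int_adjoin_diff: "x \<in> int_adjoin \<beta> \<Longrightarrow> y \<in> int_adjoin \<beta> \<Longrightarrow> x - y \<in> int_adjoin \<beta>"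
  using int_adjoin.add[OF _ int_adjoin.uminus] by fastforce

lemma int_adjoin_zero: "0 \<in> int_adjoin \<beta>"
  using int_adjoin_diff[OF int_adjoin.one int_adjoin.one] by simp

lemma int_adjoin_power: "x \<in> int_adjoin \<beta> \<Longrightarrow> x ^ i \<in> int_adjoin \<beta>"
  by (induction i) (auto intro: int_adjoin.intros)

lemma int_adjoin_of_nat: "of_nat i \<in> int_adjoin \<beta>"
  by (induction i) (auto intro: int_adjoin.intros int_adjoin_zero)

lemma int_adjoin_of_int: "of_int i \<in> int_adjoin \<beta>"
  by (cases i rule: int_cases2) (auto intro: int_adjoin.uminus int_adjoin_of_nat)

lemma int_adjoin_sum: "(\<And>i. i \<in> I \<Longrightarrow> f i \<in> int_adjoin \<beta>) \<Longrightarrow> sum f I \<in> int_adjoin \<beta>"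
  by (induction I rule: infinite_finite_induct) (auto intro: int_adjoin.add int_adjoin_zero)

lemmas int_adjoin_intros = int_adjoin.intros int_adjoin_diff int_adjoin_zero int_adjoin_power
  int_adjoin_of_nat int_adjoin_of_int int_adjoin_sum

text \<open>
  The ideal \<open>p \<int>[\<beta>]\<close>; membership of a difference expresses congruence modulo \<open>p\<close>.
\<close>

definition int_adjoin_multiples :: "nat \<Rightarrow> 'a::comm_ring_1 \<Rightarrow> 'a set" where
  "int_adjoin_multiples p \<beta> = (*) (of_nat p) ` int_adjoin \<beta>"

lemma multiplesI: "b \<in> int_adjoin \<beta> \<Longrightarrow> of_nat p * b \<in> int_adjoin_multiples p \<beta>"
  by (simp add: int_adjoin_multiples_def)

lemma multiples_zero: "0 \<in> int_adjoin_multiples p \<beta>"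
  using multiplesI[OF int_adjoin_zero, of p \<beta>] by simp

lemma multiples_add:
  assumes "x \<in> int_adjoin_multiples p \<beta>" "y \<in> int_adjoin_multiples p \<beta>"
  shows "x + y \<in> int_adjoin_multiples p \<beta>"
proof -
  obtain a b where "a \<in> int_adjoin \<beta>" "b \<in> int_adjoin \<beta>" "x = of_nat p * a" "y = of_nat p * b"
    using assms by (auto simp: int_adjoin_multiples_def)
  then show ?thesis using multiplesI[OF int_adjoin.add, of a \<beta> b p] by (simp add: algebra_simps)
qed

lemma multiples_mult:
  assumes "x \<in> int_adjoin_multiples p \<beta>" "y \<in> int_adjoin \<beta>"
  shows "y * x \<in> int_adjoin_multiples p \<beta>"
proof -
  obtain a where "a \<in> int_adjoin \<beta>" "x = of_nat p * a"
    using assms by (auto simp: int_adjoin_multiples_def)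
  then show ?thesis using multiplesI[OF int_adjoin.mult, of y \<beta> a p] assms by (simp add: ac_simps)
qed

lemma multiples_uminus:
  "x \<in> int_adjoin_multiples p \<beta> \<Longrightarrow> - x \<in> int_adjoin_multiples p \<beta>"
  using multiples_mult[of x p \<beta> "- 1"] by (simp add: int_adjoin_intros)

lemma multiples_diff:
  "x \<in> int_adjoin_multiples p \<beta> \<Longrightarrow> y \<in> int_adjoin_multiples p \<beta> \<Longrightarrow> x - y \<in> int_adjoin_multiples p \<beta>"
  using multiples_add[OF _ multiples_uminus] by fastforce

lemma multiples_sum:
  "(\<And>i. i \<in> I \<Longrightarrow> f i \<in> int_adjoin_multiples p \<beta>) \<Longrightarrow> sum f I \<in> int_adjoin_multiples p \<beta>"
  by (induction I rule: infinite_finite_induct) (auto intro: multiples_add multiples_zero)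

lemma prime_dvd_binomial_prime_power:
  assumes "Factorial_Ring.prime p" "0 < i" "i < p ^ n"
  shows "p dvd (p ^ n choose i)"
proof (rule ccontr)
  assume "\<not> p dvd (p ^ n choose i)"
  then have "coprime (p ^ n) (p ^ n choose i)"
    using prime_imp_coprime[OF assms(1)] by (simp add: coprime_power_left_iff)
  moreover have "p ^ n dvd i * (p ^ n choose i)"
    using times_binomial_minus1_eq[OF assms(2), of "p ^ n"] by simp
  ultimately have "p ^ n dvd i"
    by (simp add: coprime_dvd_mult_left_iff)
  then show False using assms(2,3) dvd_imp_le by fastforce
qed

lemma binomial_middle_terms:
  fixes x y :: "'a::comm_ring_1"
  assumes "q > 0"
  shows "(x + y) ^ q - x ^ q - y ^ q = (\<Sum>i\<in>{0<..<q}. of_nat (q choose i) * (x ^ i * y ^ (q - i)))"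
proof -
  have "{..q} = insert 0 (insert q {0<..<q})" using assms by auto
  then show ?thesis using assms by (simp add: binomial_ring ac_simps)
qed

lemma binomial_term_multiple:
  assumes "Factorial_Ring.prime p" "i \<in> {0<..<p ^ n}" "x \<in> int_adjoin \<beta>"
  shows "of_nat (p ^ n choose i) * x \<in> int_adjoin_multiples p \<beta>"
proof -
  obtain c where "p ^ n choose i = p * c"
    using prime_dvd_binomial_prime_power assms(1,2) by (metis dvdE greaterThanLessThan_iff)
  then show ?thesis
    using multiplesI[of "of_nat c * x" \<beta> p] assms(3) by (simp add: int_adjoin_intros mult.assoc)
qed

text \<open>
  Modulo \<open>p\<close> the map \<open>y \<mapsto> y\<^sup>q\<close> with \<open>q = p\<^sup>n\<close> is a ring homomorphism, since \<open>p\<close> divides the inner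
  binomial coefficients; so it is the identity as soon as it fixes the generator.
\<close>

lemma frobenius_fixes_int_adjoin:
  assumes p: "Factorial_Ring.prime p" "odd (p ^ n)"
    and \<beta>: "\<beta> ^ (p ^ n) - \<beta> \<in> int_adjoin_multiples p \<beta>"
    and y: "y \<in> int_adjoin \<beta>"
  shows "y ^ (p ^ n) - y \<in> int_adjoin_multiples p \<beta>"
  using y
proof induction
  case one
  then show ?case by (simp add: multiples_zero)
next
  case gen
  then show ?case by (rule \<beta>)
next
  case (uminus x)
  then show ?case using multiples_uminus[OF uminus.IH] p(2) by simp
next
  case (add x y)
  have pos: "p ^ n > 0" using p(1) prime_gt_0_nat by simp
  have "(x + y) ^ p ^ n - x ^ p ^ n - y ^ p ^ n \<in> int_adjoin_multiples p \<beta>"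
    unfolding binomial_middle_terms[OF pos]
    by (intro multiples_sum binomial_term_multiple p(1) int_adjoin_intros add.hyps)
  from multiples_add[OF multiples_add[OF this add.IH(1)] add.IH(2)]
  show ?case by (simp add: algebra_simps)
next
  case (mult x y)
  have "x ^ p ^ n * (y ^ p ^ n - y) + y * (x ^ p ^ n - x) \<in> int_adjoin_multiples p \<beta>"
    by (intro multiples_add multiples_mult mult int_adjoin_intros)
  then show ?case by (simp add: algebra_simps)
qed

text \<open>
  Since \<open>\<zeta> \<cdot> \<zeta>\<^sup>-\<^sup>1 = 1\<close>, the symmetric expression reduces to a power sum \<open>\<zeta>\<^sup>d + \<zeta>\<^sup>-\<^sup>d\<close>, and these satisfy a
  linear recurrence over \<open>\<int>[\<zeta> + \<zeta>\<^sup>-\<^sup>1]\<close>.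
\<close>

lemma power_sum_in_int_adjoin:
  fixes \<zeta> :: "'a::field"
  assumes "\<zeta> \<noteq> 0"
  shows "\<zeta> ^ i * inverse \<zeta> ^ j + \<zeta> ^ j * inverse \<zeta> ^ i \<in> int_adjoin (\<zeta> + inverse \<zeta>)"
proof -
  let ?\<beta> = "\<zeta> + inverse \<zeta>"
  have unit: "\<zeta> * inverse \<zeta> = 1" using assms by simp
  have base: "\<zeta> ^ d + inverse \<zeta> ^ d \<in> int_adjoin ?\<beta>" for d
  proof (induction d rule: induct_nat_012)
    case 0
    show ?case using int_adjoin.add[OF int_adjoin.one int_adjoin.one, of ?\<beta>] by simp
  next
    case 1
    show ?case using int_adjoin.gen[of ?\<beta>] by simp
  next
    case (ge2 d)
    have "\<zeta> ^ Suc (Suc d) + inverse \<zeta> ^ Suc (Suc d)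
        = ?\<beta> * (\<zeta> ^ Suc d + inverse \<zeta> ^ Suc d) - (\<zeta> * inverse \<zeta>) * (\<zeta> ^ d + inverse \<zeta> ^ d)"
      by (simp add: algebra_simps)
    then show ?case unfolding unit
      using int_adjoin_diff[OF int_adjoin.mult[OF int_adjoin.gen ge2(2)] ge2(1)] by simp
  qed
  have le: "\<zeta> ^ i * inverse \<zeta> ^ j + \<zeta> ^ j * inverse \<zeta> ^ i \<in> int_adjoin ?\<beta>" if ij: "i \<le> j" for i j
  proof -
    obtain d where d: "j = i + d" using le_Suc_ex[OF ij] by blast
    have "\<zeta> ^ i * inverse \<zeta> ^ j + \<zeta> ^ j * inverse \<zeta> ^ i
        = (\<zeta> * inverse \<zeta>) ^ i * (\<zeta> ^ d + inverse \<zeta> ^ d)"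
      unfolding d by (simp only: power_mult_distrib power_add distrib_left ac_simps)
    then show ?thesis using base unfolding unit by simp
  qed
  show ?thesis using le[of i j] le[of j i] by (cases "i \<le> j") (auto simp: add.commute)
qed

text \<open>
  The congruence on \<open>q = p\<^sup>n\<close> makes \<open>\<zeta>\<^sup>q\<close> equal to \<open>\<zeta>\<close> or \<open>\<zeta>\<^sup>-\<^sup>1\<close>, so \<open>\<zeta>\<^sup>q + \<zeta>\<^sup>-\<^sup>q = \<beta>\<close> and the difference in
  question consists of the inner terms of the binomial expansion of \<open>\<beta>\<^sup>q\<close>. A single term need not
  lie in \<open>\<int>[\<beta>]\<close>, but its sum with the mirror term does; adding the expansion to its reversal
  therefore puts twice the difference into \<open>p \<int>[\<beta>]\<close>, and \<open>2\<close> is invertible modulo \<open>p\<close>.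
\<close>

lemma frobenius_fixes_cyclotomic_trace:
  fixes \<zeta> :: "'a::field"
  assumes p: "Factorial_Ring.prime p" "odd (p ^ n)" and \<zeta>: "\<zeta> ^ N = 1" "N > 0"
    and q: "[p ^ n = 1] (mod N) \<or> [p ^ n + 1 = 0] (mod N)"
  defines "\<beta> \<equiv> \<zeta> + inverse \<zeta>"
  shows "\<beta> ^ (p ^ n) - \<beta> \<in> int_adjoin_multiples p \<beta>"
proof (cases "n = 0")
  case False
  define q where "q = p ^ n"
  have "q > 0" using p(1) prime_gt_0_nat by (simp add: q_def)
  have nz: "\<zeta> \<noteq> 0" using \<zeta> by (auto simp: power_0_left)
  have period: "\<zeta> ^ i = \<zeta> ^ j" if "[i = j] (mod N)" for i j
  proof -
    have mod: "\<zeta> ^ i = \<zeta> ^ (i mod N)" for i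
    proof -
      have "\<zeta> ^ (N * (i div N) + i mod N) = \<zeta> ^ (i mod N)"
        unfolding power_add power_mult \<zeta>(1) by simp
      then show ?thesis by simp
    qed
    show ?thesis using mod[of i] mod[of j] that by (simp add: cong_def)
  qed
  have "\<zeta> ^ q = \<zeta> \<or> \<zeta> ^ q = inverse \<zeta>"
  proof (rule disjE[OF assms(5)])
    assume "[p ^ n = 1] (mod N)"
    then show ?thesis using period[of q 1] by (simp add: q_def)
  next
    assume "[p ^ n + 1 = 0] (mod N)"
    then have "\<zeta> ^ (q + 1) = 1" using period[of "q + 1" 0] by (simp add: q_def)
    then have "\<zeta> * \<zeta> ^ q = 1" by simp
    then show ?thesis using inverse_unique by metis
  qed
  then have fixed: "\<zeta> ^ q + inverse \<zeta> ^ q = \<beta>"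
    unfolding power_inverse \<beta>_def using nz by auto
  define e where "e = \<beta> ^ q - \<beta>"
  have "e = \<beta> ^ q - (\<zeta> ^ q + inverse \<zeta> ^ q)" unfolding fixed by (rule e_def)
  \<comment> \<open>The two expansions differ by exchanging the summands of \<open>\<beta>\<close>; adding them pairs each term with its mirror image.\<close>
  then have e: "e = (\<zeta> + inverse \<zeta>) ^ q - \<zeta> ^ q - inverse \<zeta> ^ q"
    "e = (inverse \<zeta> + \<zeta>) ^ q - inverse \<zeta> ^ q - \<zeta> ^ q"
    by (simp_all add: \<beta>_def add.commute)
  have "e + e = (\<Sum>i\<in>{0<..<q}. of_nat (q choose i) * (\<zeta> ^ i * inverse \<zeta> ^ (q - i)))
      + (\<Sum>i\<in>{0<..<q}. of_nat (q choose i) * (inverse \<zeta> ^ i * \<zeta> ^ (q - i)))"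
    using e unfolding binomial_middle_terms[OF \<open>q > 0\<close>] by (rule arg_cong2[where f = plus])
  also have "\<dots> = (\<Sum>i\<in>{0<..<q}. of_nat (q choose i)
      * (\<zeta> ^ i * inverse \<zeta> ^ (q - i) + \<zeta> ^ (q - i) * inverse \<zeta> ^ i))"
    by (simp only: sum.distrib distrib_left mult.commute)
  also have "\<dots> \<in> int_adjoin_multiples p \<beta>"
    unfolding q_def \<beta>_def
    by (intro multiples_sum binomial_term_multiple p(1) power_sum_in_int_adjoin nz)
  finally have "e + e \<in> int_adjoin_multiples p \<beta>" .
  moreover obtain r where r: "p = 2 * r + 1" using p(2) False by (auto elim: oddE)
  moreover have eB: "e \<in> int_adjoin \<beta>" unfolding e_def by (intro int_adjoin_intros)
  \<comment> \<open>\<open>p - 2 r = 1\<close> recovers \<open>e\<close> from \<open>p e\<close> and \<open>2 e\<close>.\<close>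
  ultimately have "of_nat p * e - of_nat r * (e + e) \<in> int_adjoin_multiples p \<beta>"
    by (intro multiples_diff[OF multiplesI multiples_mult] int_adjoin_of_nat)
  also have "of_nat p * e - of_nat r * (e + e) = e"
    unfolding r by (simp add: algebra_simps)
  finally show ?thesis by (simp add: e_def q_def)
qed (simp add: multiples_zero)

text \<open>
  This is integral closedness at \<open>p\<close>. If \<open>z\<close> is a zero of a monic integer polynomial of degree \<open>r\<close>,
  then clearing denominators shows that \<open>y = p z\<close> satisfies \<open>y\<^sup>r \<equiv> 0\<close> modulo \<open>p \<int>[\<beta>]\<close>. But \<open>y\<close> is
  congruent to arbitrarily high powers of itself, so \<open>y \<equiv> 0\<close> as well, that is, \<open>z\<close> is in \<open>\<int>[\<beta>]\<close>.
\<close>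

lemma algebraic_int_in_int_adjoin:
  fixes \<beta> z :: "'a::field_char_0"
  assumes q: "p > 0" "q \<ge> 2"
    and frob: "\<And>y. y \<in> int_adjoin \<beta> \<Longrightarrow> y ^ q - y \<in> int_adjoin_multiples p \<beta>"
    and z: "algebraic_int z" "of_nat p * z \<in> int_adjoin \<beta>"
  shows "z \<in> int_adjoin \<beta>"
proof -
  define y where "y = of_nat p * z"
  have yB: "y \<in> int_adjoin \<beta>" using z(2) by (simp add: y_def)
  obtain f where f: "Polynomial.lead_coeff f = 1" "\<forall>i. Polynomial.coeff f i \<in> \<int>" "poly f z = 0"
    using z(1) by (auto simp: algebraic_int.simps)
  define r where "r = Polynomial.degree f"
  have "(\<Sum>i<r. Polynomial.coeff f i * z ^ i) + z ^ r = 0"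
    using f(1,3) by (simp add: poly_altdef r_def lessThan_Suc_atMost[symmetric])
  then have "y ^ r = - (of_nat p ^ r * (\<Sum>i<r. Polynomial.coeff f i * z ^ i))"
    unfolding y_def power_mult_distrib by (simp add: add_eq_0_iff)
  also have "of_nat p ^ r * (\<Sum>i<r. Polynomial.coeff f i * z ^ i)
      = (\<Sum>i<r. of_nat p * (Polynomial.coeff f i * of_nat p ^ (r - i - 1) * y ^ i))"
    unfolding sum_distrib_left
  proof (intro sum.cong refl)
    fix i assume "i \<in> {..<r}"
    then have "of_nat p ^ r = (of_nat p * of_nat p ^ (r - i - 1) * of_nat p ^ i :: 'a)"
      by (simp flip: power_Suc power_add)
    then show "of_nat p ^ r * (Polynomial.coeff f i * z ^ i)
      = of_nat p * (Polynomial.coeff f i * of_nat p ^ (r - i - 1) * y ^ i)"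
      by (simp add: y_def power_mult_distrib)
  qed
  also have "- \<dots> \<in> int_adjoin_multiples p \<beta>"
  proof (intro multiples_uminus multiples_sum multiplesI)
    fix i
    have "Polynomial.coeff f i \<in> int_adjoin \<beta>"
      using f(2) int_adjoin_of_int by (metis Ints_cases)
    then show "Polynomial.coeff f i * of_nat p ^ (r - i - 1) * y ^ i \<in> int_adjoin \<beta>"
      using yB by (intro int_adjoin_intros)
  qed
  finally have yr: "y ^ r \<in> int_adjoin_multiples p \<beta>" .
  have iter: "y ^ (q ^ j) - y \<in> int_adjoin_multiples p \<beta>" for j
  proof (induction j)
    case (Suc j)
    have "(y ^ (q ^ j)) ^ q - y ^ (q ^ j) \<in> int_adjoin_multiples p \<beta>"
      by (intro frob int_adjoin_intros yB)
    from multiples_add[OF this Suc] show ?case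
      by (simp add: power_mult[symmetric] mult.commute)
  qed (simp add: multiples_zero)
  have "r \<le> q ^ r"
    by (rule order_trans[OF less_imp_le[OF less_exp] power_mono[OF q(2)]]) simp
  then have "y ^ (q ^ r) = y ^ (q ^ r - r) * y ^ r" by (simp flip: power_add)
  then have "y ^ (q ^ r) \<in> int_adjoin_multiples p \<beta>"
    using multiples_mult[OF yr int_adjoin_power[OF yB]] by simp
  from multiples_diff[OF this iter[of r]] have "y \<in> int_adjoin_multiples p \<beta>" by simp
  then show ?thesis using q(1) by (auto simp: int_adjoin_multiples_def y_def)
qed

text \<open>
  Factors \<open>p\<close> of a denominator can be cancelled one at a time.
\<close>

lemma coprime_denominator:
  fixes \<beta> x :: "'a::field_char_0"
  assumes p: "Factorial_Ring.prime p"
    and sat: "\<And>z. algebraic_int z \<Longrightarrow> of_nat p * z \<in> int_adjoin \<beta> \<Longrightarrow> z \<in> int_adjoin \<beta>"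
    and x: "\<And>d. algebraic_int (of_nat d * x)"
    and d: "d > 0" "of_nat d * x \<in> int_adjoin \<beta>"
  shows "\<exists>d. \<not> p dvd d \<and> of_nat d * x \<in> int_adjoin \<beta>"
  using d
proof (induction d rule: less_induct)
  case (less d)
  show ?case
  proof (cases "p dvd d")
    case True
    then obtain e where e: "d = p * e" by blast
    then have "of_nat e * x \<in> int_adjoin \<beta>"
      using sat[OF x[of e]] less.prems(2) by (simp add: mult.assoc)
    moreover have "0 < e" "e < d" using e less.prems(1) prime_ge_2_nat[OF p] by auto
    ultimately show ?thesis using less.IH by blast
  qed (use less.prems in blast)
qed

section \<open>Fractions and the adjunction of one element to the rationals\<close>

text \<open>
  This is \<open>\<rat>[\<beta>]\<close>, presented so that its elements come with an integer denominator.
\<close>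

definition int_adjoin_fractions :: "'a::field_char_0 \<Rightarrow> 'a set" where
  "int_adjoin_fractions \<beta> = {x. \<exists>d>0. of_nat d * x \<in> int_adjoin \<beta>}"

lemma fractions_of_int_adjoin: "x \<in> int_adjoin \<beta> \<Longrightarrow> x \<in> int_adjoin_fractions \<beta>"
  by (auto simp: int_adjoin_fractions_def intro!: exI[of _ "1::nat"])

lemma fractions_uminus: "x \<in> int_adjoin_fractions \<beta> \<Longrightarrow> - x \<in> int_adjoin_fractions \<beta>"
  by (auto simp: int_adjoin_fractions_def dest: int_adjoin.uminus)

lemma fractions_add:
  assumes "x \<in> int_adjoin_fractions \<beta>" "y \<in> int_adjoin_fractions \<beta>"
  shows "x + y \<in> int_adjoin_fractions \<beta>"
proof -
  obtain d e where "d > 0" "e > 0" "of_nat d * x \<in> int_adjoin \<beta>" "of_nat e * y \<in> int_adjoin \<beta>"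
    using assms by (auto simp: int_adjoin_fractions_def)
  moreover from this have "of_nat e * (of_nat d * x) + of_nat d * (of_nat e * y) \<in> int_adjoin \<beta>"
    by (intro int_adjoin.add int_adjoin.mult[of _ \<beta> "of_nat d * x"]
        int_adjoin.mult[of _ \<beta> "of_nat e * y"] int_adjoin_of_nat)
  ultimately show ?thesis
    by (auto simp: int_adjoin_fractions_def algebra_simps intro!: exI[of _ "d * e"])
qed

lemma fractions_mult:
  assumes "x \<in> int_adjoin_fractions \<beta>" "y \<in> int_adjoin_fractions \<beta>"
  shows "x * y \<in> int_adjoin_fractions \<beta>"
proof -
  obtain d e where "d > 0" "e > 0" "of_nat d * x \<in> int_adjoin \<beta>" "of_nat e * y \<in> int_adjoin \<beta>"
    using assms by (auto simp: int_adjoin_fractions_def)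
  moreover from this have "(of_nat d * x) * (of_nat e * y) \<in> int_adjoin \<beta>"
    by (intro int_adjoin.mult[of "of_nat d * x" \<beta> "of_nat e * y"])
  ultimately show ?thesis
    by (auto simp: int_adjoin_fractions_def algebra_simps intro!: exI[of _ "d * e"])
qed

lemma fractions_of_rat: "of_rat r \<in> int_adjoin_fractions \<beta>"
proof -
  obtain a b where r: "r = Rat.Fract a b" "b > 0" by (cases r)
  then have "of_nat (nat b) * of_rat r = (of_int a :: 'a)"
    by (simp add: of_rat_rat)
  then show ?thesis using r(2) int_adjoin_of_int[of a \<beta>]
    unfolding int_adjoin_fractions_def by (auto intro!: exI[of _ "nat b"])
qed

definition rat_eval :: "'a::field_char_0 \<Rightarrow> rat poly \<Rightarrow> 'a" where
  "rat_eval \<beta> f = poly (map_poly of_rat f) \<beta>"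

lemma rat_eval_pCons [simp]: "rat_eval \<beta> (pCons a f) = of_rat a + \<beta> * rat_eval \<beta> f"
  by (simp add: rat_eval_def map_poly_pCons)

lemma rat_eval_zero [simp]: "rat_eval \<beta> 0 = 0"
  by (simp add: rat_eval_def)

lemma rat_eval_one [simp]: "rat_eval \<beta> 1 = 1"
  by (simp add: one_pCons)

lemma rat_eval_add [simp]: "rat_eval \<beta> (f + g) = rat_eval \<beta> f + rat_eval \<beta> g"
  by (induction f g rule: poly_induct2) (simp_all add: of_rat_add algebra_simps)

lemma rat_eval_smult [simp]: "rat_eval \<beta> (Polynomial.smult a f) = of_rat a * rat_eval \<beta> f"
  by (induction f) (simp_all add: of_rat_mult algebra_simps)

lemma rat_eval_uminus [simp]: "rat_eval \<beta> (- f) = - rat_eval \<beta> f"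
  using rat_eval_smult[of \<beta> "- 1" f] by (simp add: of_rat_minus)

lemma rat_eval_mult [simp]: "rat_eval \<beta> (f * g) = rat_eval \<beta> f * rat_eval \<beta> g"
  by (induction f) (simp_all add: algebra_simps)

lemma fractions_eq_rat_eval: "int_adjoin_fractions \<beta> = range (rat_eval \<beta>)"
proof (intro equalityI subsetI)
  fix x assume "x \<in> int_adjoin_fractions \<beta>"
  then obtain d where d: "d > 0" "of_nat d * x \<in> int_adjoin \<beta>"
    by (auto simp: int_adjoin_fractions_def)
  have "y \<in> range (rat_eval \<beta>)" if "y \<in> int_adjoin \<beta>" for y
    using that
  proof induction
    case one
    show ?case by (rule range_eqI[of _ _ 1]) simp
  next
    case gen
    show ?case by (rule range_eqI[of _ _ "[:0, 1:]"]) simp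
  next
    case (uminus x)
    then obtain f where "x = rat_eval \<beta> f" by blast
    then show ?case by (intro range_eqI[of _ _ "- f"]) simp
  next
    case (add x y)
    then obtain f g where "x = rat_eval \<beta> f" "y = rat_eval \<beta> g" by blast
    then show ?case by (intro range_eqI[of _ _ "f + g"]) simp
  next
    case (mult x y)
    then obtain f g where "x = rat_eval \<beta> f" "y = rat_eval \<beta> g" by blast
    then show ?case by (intro range_eqI[of _ _ "f * g"]) simp
  qed
  with d(2) obtain f where "of_nat d * x = rat_eval \<beta> f" by blast
  then have "x = rat_eval \<beta> (Polynomial.smult (inverse (of_nat d)) f)"
    using d(1) by (simp add: of_rat_inverse of_rat_divide field_simps)
  then show "x \<in> range (rat_eval \<beta>)" by blast
next
  fix x assume "x \<in> range (rat_eval \<beta>)"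
  then obtain f where "x = rat_eval \<beta> f" by blast
  moreover have "rat_eval \<beta> f \<in> int_adjoin_fractions \<beta>" for f
    by (induction f) (auto intro!: fractions_add fractions_mult fractions_of_rat
        intro: fractions_of_int_adjoin int_adjoin.intros int_adjoin_zero)
  ultimately show "x \<in> int_adjoin_fractions \<beta>" by simp
qed

text \<open>
  Let \<open>g\<close> have minimal degree among the nonzero rational polynomials vanishing at \<open>\<beta>\<close>. A polynomial
  \<open>h\<close> with \<open>h(\<beta>) \<noteq> 0\<close> has a constant greatest common divisor with \<open>g\<close>, and a Bezout identity
  evaluated at \<open>\<beta>\<close> inverts \<open>h(\<beta>)\<close>.
\<close>

lemma fractions_inverse:
  assumes alg: "algebraic \<beta>" and x: "x \<in> int_adjoin_fractions \<beta>" "x \<noteq> 0"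
  shows "inverse x \<in> int_adjoin_fractions \<beta>"
proof -
  obtain f0 where f0: "f0 \<noteq> 0" "poly (map_poly of_int f0) \<beta> = 0"
    using alg by (rule algebraicE')
  define g0 :: "rat poly" where "g0 = map_poly of_int f0"
  have "g0 \<noteq> 0" using f0(1) by (simp add: g0_def map_poly_eq_0_iff)
  moreover have "rat_eval \<beta> g0 = 0"
    using f0(2) by (simp add: rat_eval_def g0_def map_poly_map_poly o_def)
  ultimately obtain g where g: "g \<noteq> 0" "rat_eval \<beta> g = 0"
    and min: "\<And>f. f \<noteq> 0 \<Longrightarrow> rat_eval \<beta> f = 0 \<Longrightarrow> Polynomial.degree g \<le> Polynomial.degree f"
    using ex_has_least_nat[of "\<lambda>g. g \<noteq> 0 \<and> rat_eval \<beta> g = 0" g0 Polynomial.degree] by auto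
  obtain h where h: "x = rat_eval \<beta> h" using x(1) unfolding fractions_eq_rat_eval by blast
  define d where "d = gcd h g"
  obtain u v where uv: "u * h + v * g = d"
    using bezout_coefficients_fst_snd[of h g] by (auto simp: d_def)
  then have d_eval: "rat_eval \<beta> d = rat_eval \<beta> u * x" using g(2) h by (metis
    add.right_neutral mult_zero_right rat_eval_add rat_eval_mult)
  obtain h' where "h = d * h'" unfolding d_def by (meson dvdE gcd_dvd1)
  then have "rat_eval \<beta> d \<noteq> 0" using h x(2) by auto
  obtain e where e: "g = d * e" unfolding d_def by (meson dvdE gcd_dvd2)
  then have "rat_eval \<beta> e = 0" "e \<noteq> 0" "d \<noteq> 0"
    using g \<open>rat_eval \<beta> d \<noteq> 0\<close> by auto
  then have "Polynomial.degree d = 0"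
    using min[of e] e by (simp add: degree_mult_eq)
  then obtain c where c: "d = [:c:]" by (meson degree_eq_zeroE)
  then have "of_rat c = rat_eval \<beta> u * x" "c \<noteq> 0" using d_eval \<open>d \<noteq> 0\<close> by auto
  then have "rat_eval \<beta> (Polynomial.smult (inverse c) u) * x = of_rat (inverse c) * of_rat c"
    by simp
  also have "\<dots> = 1" using \<open>c \<noteq> 0\<close> by (simp flip: of_rat_mult)
  finally have "rat_eval \<beta> (Polynomial.smult (inverse c) u) * x = 1" .
  then have "inverse x = rat_eval \<beta> (Polynomial.smult (inverse c) u)"
    using inverse_unique[of x] by (simp add: mult.commute)
  then show ?thesis unfolding fractions_eq_rat_eval by blast
qed

lemma uminus_type_algebra: "\<ominus>\<^bsub>ring_of_type_algebra\<^esub> x = - (x::'a::comm_ring_1)"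
proof -
  interpret cring "ring_of_type_algebra :: 'a ring" by (rule cring_from_type_algebra)
  show ?thesis by (rule minus_equality) (simp_all add: ring_of_type_algebra_def)
qed

lemma inverse_type_algebra:
  assumes "x \<noteq> (0::'a::field)"
  shows "inv\<^bsub>ring_of_type_algebra\<^esub> x = inverse x"
proof -
  interpret field "ring_of_type_algebra :: 'a ring" by (rule field_from_type_algebra)
  show ?thesis using assms by (intro comm_inv_char) (simp_all add: ring_of_type_algebra_def)
qed

lemma adjoin_rat_subset_fractions:
  assumes "algebraic \<beta>" "x \<in> adjoin_rat {\<beta>}"
  shows "x \<in> int_adjoin_fractions \<beta>"
  using assms(2) unfolding adjoin_rat_def
proof induction
  case one
  then show ?case by (simp add: ring_of_type_algebra_def fractions_of_int_adjoin int_adjoin.one)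
next
  case (incl h)
  then show ?case by (simp add: fractions_of_int_adjoin int_adjoin.gen)
next
  case (a_inv h)
  then show ?case by (simp add: uminus_type_algebra fractions_uminus)
next
  case (m_inv h)
  then have "h \<noteq> 0" by (simp add: ring_of_type_algebra_def)
  then show ?case using m_inv by (simp add: inverse_type_algebra fractions_inverse[OF assms(1)])
qed (simp_all add: ring_of_type_algebra_def fractions_add fractions_mult)

lemma int_adjoin_subset_adjoin_rat: "int_adjoin \<beta> \<subseteq> adjoin_rat {\<beta>}"
proof
  fix x assume "x \<in> int_adjoin \<beta>"
  then show "x \<in> adjoin_rat {\<beta>}"
  proof induction
    case one
    show ?case using generate_field.one[of ring_of_type_algebra "{\<beta>}"]
      by (simp add: adjoin_rat_def ring_of_type_algebra_def)
  next
    case gen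
    show ?case by (simp add: adjoin_rat_def generate_field.incl)
  next
    case (uminus x)
    then show ?case using generate_field.a_inv[of x ring_of_type_algebra]
      by (simp add: adjoin_rat_def uminus_type_algebra)
  next
    case (add x y)
    then show ?case using generate_field.eng_add[of x ring_of_type_algebra _ y]
      by (simp add: adjoin_rat_def ring_of_type_algebra_def)
  next
    case (mult x y)
    then show ?case using generate_field.eng_mult[of x ring_of_type_algebra _ y]
      by (simp add: adjoin_rat_def ring_of_type_algebra_def)
  qed
qed

section \<open>Residue fields on which a power map is the identity\<close>

context ring begin

lemma line_extension_eq_image: "line_extension K v E = (\<lambda>(k, e). k \<otimes> v \<oplus> e) ` (K \<times> E)"
  unfolding set_eq_iff line_extension_mem_iff image_iff by force

lemma card_line_extension:
  assumes K: "subfield K R" "finite K" and E: "dimension m K E" "finite E"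
    and v: "v \<in> carrier R" "v \<notin> E"
  shows "card (line_extension K v E) = card K * card E"
proof -
  note E_props = space_subgroup_props[OF K(1) E(1)]
  have EC: "E \<subseteq> carrier R" by (rule E_props(1))
  have KC: "K \<subseteq> carrier R" using subring_props(1)[OF K(1)] .
  have "inj_on (\<lambda>(k, e). k \<otimes> v \<oplus> e) (K \<times> E)"
  proof (rule inj_onI, clarify)
    fix k e k' e' assume mem: "k \<in> K" "k' \<in> K" "e \<in> E" "e' \<in> E"
      and eq: "k \<otimes> v \<oplus> e = k' \<otimes> v \<oplus> e'"
    have C: "k \<in> carrier R" "k' \<in> carrier R" "e \<in> carrier R" "e' \<in> carrier R"
      using mem KC EC by auto
    define d where "d = k \<ominus> k'"
    have dC: "d \<in> carrier R" using C by (simp add: d_def)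
    have "d \<otimes> v = (k \<otimes> v \<oplus> e) \<ominus> (k' \<otimes> v \<oplus> e')  \<oplus> (e' \<ominus> e)"
      using C v(1) unfolding d_def minus_eq
      by (simp add: l_distr l_minus minus_add a_ac r_neg r_neg1 r_neg2)
    also have "\<dots> = e' \<ominus> e" using eq C v(1) by (simp add: r_neg minus_eq)
    finally have dv: "d \<otimes> v = e' \<ominus> e" .
    moreover have "e' \<ominus> e \<in> E"
      using mem E_props(3,4) by (simp add: minus_eq)
    ultimately have "d \<otimes> v \<in> E" by simp
    then have "d \<notin> K - {\<zero>}"
      using E_props(6)[of d v] v by blast
    moreover have "d \<in> K"
      using mem subring_props(5,7)[OF K(1)] by (simp add: d_def minus_eq)
    ultimately have "k = k'"
      using C r_right_minus_eq by (simp add: d_def)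
    with eq C v(1) show "k = k' \<and> e = e'" by simp
  qed
  then show ?thesis
    by (simp add: line_extension_eq_image card_image card_cartesian_product)
qed

lemma card_dimension:
  assumes K: "subfield K R" "finite K" and "dimension m K E"
  shows "finite E \<and> card E = card K ^ m"
  using assms(3,1,2)
proof (induction rule: dimension.induct)
  case (Suc_dim v E m K)
  then have "finite (line_extension K v E)" by (simp add: line_extension_eq_image)
  with Suc_dim card_line_extension[of K m E v] show ?case by simp
qed simp

end

text \<open>
  Reduce \<open>n\<close> modulo \<open>m\<close>: as \<open>p\<^sup>m \<equiv> 1\<close>, the remainder \<open>r\<close> satisfies \<open>p\<^sup>r \<equiv> 1\<close> modulo \<open>p\<^sup>m - 1\<close>, but
  \<open>p\<^sup>r - 1 < p\<^sup>m - 1\<close>.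
\<close>

lemma power_minus_one_dvd:
  fixes p m n :: nat
  assumes "p \<ge> 2" "m > 0" "p ^ m - 1 dvd p ^ n - 1"
  shows "m dvd n"
proof -
  have *: "[p ^ n = 1] (mod (p ^ m - 1))"
    using assms by (simp add: cong_altdef_nat)
  have "[p ^ m = 1] (mod (p ^ m - 1))"
    using assms by (simp add: cong_altdef_nat)
  then have "[(p ^ m) ^ (n div m) * p ^ (n mod m) = 1 ^ (n div m) * p ^ (n mod m)] (mod (p ^ m - 1))"
    by (intro cong_mult cong_pow) auto
  moreover have "(p ^ m) ^ (n div m) * p ^ (n mod m) = p ^ n"
    by (simp flip: power_mult power_add)
  ultimately have "[p ^ (n mod m) = 1] (mod (p ^ m - 1))"
    using * by (metis cong_sym cong_trans mult_1 power_one)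
  then have "p ^ m - 1 dvd p ^ (n mod m) - 1"
    using assms by (simp add: cong_altdef_nat)
  moreover have "p ^ (n mod m) - 1 < p ^ m - 1"
    using assms by (intro diff_less_mono power_strict_increasing) auto
  ultimately have "p ^ (n mod m) - 1 = 0" using dvd_imp_le by fastforce
  then have "n mod m = 0" using assms(1) power_increasing[of 1 "n mod m" p] by (cases "n mod m = 0") auto
  then show ?thesis by (simp add: mod_eq_0_iff_dvd)
qed

text \<open>
  The equation \<open>x\<^sup>q = x\<close> with \<open>q = p\<^sup>n\<close> makes \<open>x\<^sup>q\<^sup>-\<^sup>2\<close> an inverse of each \<open>x \<noteq> 0\<close>, so the domain and the subring
  are fields and the domain has \<open>p\<^sup>m\<close> elements. A generator of its group of units has order
  \<open>p\<^sup>m - 1\<close>, which then divides \<open>q - 1\<close>.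
\<close>

lemma (in domain) dimension_dvd_if_power_fixes:
  assumes K: "subring K R" "card K = p" and p: "p \<ge> 2" and dim: "dimension m K (carrier R)" "m > 0"
    and n: "n > 0" and fixed: "\<And>x. x \<in> carrier R \<Longrightarrow> x [^] (p ^ n) = x"
  shows "m dvd n"
proof -
  have "p \<le> p ^ n" using n p by (simp add: self_le_power)
  then have q: "p ^ n \<ge> 2" using p by simp
  have inverse: "x \<otimes> x [^] (p ^ n - 2) = \<one>" if x: "x \<in> carrier R" "x \<noteq> \<zero>" for x
  proof -
    have "x \<otimes> (x \<otimes> x [^] (p ^ n - 2)) = x [^] (Suc (Suc (p ^ n - 2)))"
      using x(1) by (simp add: m_ac nat_pow_Suc)
    also have "Suc (Suc (p ^ n - 2)) = p ^ n" using q by simp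
    finally show ?thesis using x fixed[OF x(1)] m_lcancel[of x "x \<otimes> x [^] (p ^ n - 2)" \<one>] by simp
  qed
  have "Units R = carrier R - {\<zero>}"
  proof
    show "carrier R - {\<zero>} \<subseteq> Units R"
      using inverse by (auto simp: Units_def m_comm intro!: bexI[where x = "_ [^] _"])
    show "Units R \<subseteq> carrier R - {\<zero>}" by (auto simp: Units_def)
  qed
  then interpret field R by (rule cring_fieldI)
  have "subfield K R"
  proof (rule subfieldI'[OF K(1)])
    fix x assume x: "x \<in> K - {\<zero>}"
    then have xC: "x \<in> carrier R" using subringE(1)[OF K(1)] by auto
    have "x [^] j \<in> K" for j :: nat
      by (induction j) (use x subringE(3,6)[OF K(1)] in auto)
    moreover have "inv x = x [^] (p ^ n - 2)"
      using inverse x xC by (intro comm_inv_char) auto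
    ultimately show "inv x \<in> K" by simp
  qed
  moreover have "finite K" using K(2) p card.infinite by fastforce
  ultimately have fin: "finite (carrier R)" and card: "card (carrier R) = p ^ m"
    using card_dimension dim(1) K(2) by auto
  define M where "M = Multiplicative_Group.mult_of R"
  interpret M: group M unfolding M_def by (rule field_mult_group)
  obtain a where a: "a \<in> carrier M" "carrier M = {a [^] i | i::nat. i \<in> UNIV}"
    using finite_field_mult_group_has_gen[OF fin] unfolding M_def by auto
  have finM: "finite (carrier M)" using fin by (simp add: M_def)
  have aR: "a \<in> carrier R" "a \<noteq> \<zero>" using a(1) by (auto simp: M_def)
  have pow: "a [^]\<^bsub>M\<^esub> i = a [^] i" for i :: nat
    by (simp add: M_def Multiplicative_Group.nat_pow_mult_of)
  have "M.ord a = card (generate M {a})"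
    using M.generate_pow_card[OF a(1)] by simp
  also have "generate M {a} = carrier M"
    using M.generate_pow_on_finite_carrier[OF finM a(1)] a(2) by (auto simp: pow)
  also have "card (carrier M) = p ^ m - 1"
    using card fin by (simp add: M_def card_Diff_singleton)
  finally have ord: "M.ord a = p ^ m - 1" .
  have "a \<otimes> a [^] (p ^ n - 1) = a [^] Suc (p ^ n - 1)"
    using aR(1) nat_pow_Suc2 by simp
  also have "Suc (p ^ n - 1) = p ^ n" using q by simp
  also have "a [^] (p ^ n) = a" by (rule fixed[OF aR(1)])
  finally have "a [^] (p ^ n - 1) = \<one>"
    using aR m_lcancel[of a "a [^] (p ^ n - 1)" \<one>] by simp
  then have "a [^]\<^bsub>M\<^esub> (p ^ n - 1) = \<one>\<^bsub>M\<^esub>" unfolding pow by (simp add: M_def)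
  then have "p ^ m - 1 dvd p ^ n - 1"
    using M.pow_eq_id[OF a(1)] ord by simp
  then show ?thesis using power_minus_one_dvd p dim(2) by blast
qed

lemma nat_pow_ring_of_integers: "x [^]\<^bsub>ring_of_integers K\<^esub> (n::nat) = x ^ n"
  by (induction n) (simp_all add: ring_of_integers_def ring_of_type_algebra_def nat_pow_def mult.commute)

lemma carrier_FactRing: "carrier (R Quot I) = (+>\<^bsub>R\<^esub>) I ` carrier R"
  by (auto simp: FactRing_def A_RCOSETS_def')

text \<open>
  For an algebraic integer \<open>x\<close> of \<open>\<rat>(\<beta>)\<close> choose \<open>d\<close> prime to \<open>p\<close> with \<open>d x\<close> in \<open>\<int>[\<beta>]\<close>. The \<open>q\<close>-th
  power map fixes \<open>d x\<close> and \<open>d\<close> modulo \<open>p\<close>, so \<open>d (x\<^sup>q - x)\<close> is in the prime ideal and \<open>d\<close> is not.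
  The residue field thus satisfies the hypothesis of \<open>dimension_dvd_if_power_fixes\<close>.
\<close>

lemma inertia_degree_dvd:
  fixes \<beta> :: complex
  assumes p: "Factorial_Ring.prime p" "odd (p ^ n)" "n > 0"
    and \<beta>: "algebraic_int \<beta>" "\<beta> ^ (p ^ n) - \<beta> \<in> int_adjoin_multiples p \<beta>"
    and m: "inertia_degree (adjoin_rat {\<beta>}) p m" "m > 0"
  shows "m dvd n"
proof -
  define q where "q = p ^ n"
  define K where "K = adjoin_rat {\<beta>}"
  define O_K where "O_K = ring_of_integers K"
  have p2: "p \<ge> 2" using p(1) prime_ge_2_nat by blast
  have "p \<le> q" unfolding q_def using p(3) p2 by (simp add: self_le_power)
  then have q2: "q \<ge> 2" using p2 by simp
  obtain P where P: "primeideal P O_K" "P \<inter> \<int> = range (\<lambda>z. of_int (int p * z))"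
    and dim: "ring.dimension (O_K Quot P) m (residue_prime_field K P) (carrier (O_K Quot P))"
    using m(1) unfolding inertia_degree_def prime_above_def O_K_def K_def by blast
  interpret primeideal P O_K by (rule P(1))
  have O_K_simps: "carrier O_K = {x \<in> K. algebraic_int x}" "x \<oplus>\<^bsub>O_K\<^esub> y = x + y"
    "x \<otimes>\<^bsub>O_K\<^esub> y = x * y" "\<one>\<^bsub>O_K\<^esub> = 1" "\<zero>\<^bsub>O_K\<^esub> = 0" for x y
    by (simp_all add: O_K_def ring_of_integers_def ring_of_type_algebra_def)
  have B_K: "int_adjoin \<beta> \<subseteq> K" unfolding K_def by (rule int_adjoin_subset_adjoin_rat)
  \<comment> \<open>A prime ideal is an ideal of a ring; this supplies closure of the algebraic integers of \<open>K\<close> under addition and multiplication.\<close>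
  have O_uminus: "- x \<in> carrier O_K" "\<ominus>\<^bsub>O_K\<^esub> x = - x" if "x \<in> carrier O_K" for x
  proof -
    have "- 1 \<in> int_adjoin \<beta>" by (intro int_adjoin.uminus int_adjoin.one)
    then have "- 1 \<in> carrier O_K" using B_K by (auto simp: O_K_simps)
    then show "- x \<in> carrier O_K" using that m_closed[of "- 1" x] by (simp add: O_K_simps)
    with that show "\<ominus>\<^bsub>O_K\<^esub> x = - x" by (intro minus_equality) (simp_all add: O_K_simps)
  qed
  have O_closed: "x + y \<in> carrier O_K" "x * y \<in> carrier O_K" "x - y \<in> carrier O_K" "x ^ i \<in> carrier O_K"
    if "x \<in> carrier O_K" "y \<in> carrier O_K" for x y and i :: nat
  proof -
    show "x + y \<in> carrier O_K" "x * y \<in> carrier O_K"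
      using that a_closed[of x y] m_closed[of x y] by (simp_all add: O_K_simps(2,3))
    show "x - y \<in> carrier O_K"
      using that O_uminus(1)[of y] a_closed[of x "- y"] by (simp add: O_K_simps(2))
    show "x ^ i \<in> carrier O_K"
      using that nat_pow_closed[of x i] by (simp add: O_K_def nat_pow_ring_of_integers)
  qed
  have B_O: "x \<in> carrier O_K" if "x \<in> int_adjoin \<beta>" for x
    using that
  proof induction
    case one
    then show ?case using one_closed by (simp add: O_K_simps(4))
  next
    case gen
    then show ?case using B_K int_adjoin.gen \<beta>(1) by (auto simp: O_K_simps)
  qed (simp_all add: O_uminus O_closed)
  have nat_O: "of_nat d \<in> carrier O_K" for d by (intro B_O int_adjoin_of_nat)
  have int_P: "of_int z \<in> P \<longleftrightarrow> int p dvd z" for z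
  proof -
    have "of_int z \<in> P \<longleftrightarrow> of_int z \<in> range (\<lambda>z. of_int (int p * z) :: complex)"
      unfolding P(2)[symmetric] by simp
    also have "\<dots> \<longleftrightarrow> int p dvd z" unfolding image_iff of_int_eq_iff by (simp add: dvd_def)
    finally show ?thesis .
  qed
  have nat_P: "of_nat d \<in> P \<longleftrightarrow> p dvd d" for d
    using int_P[of "int d"] by simp
  have frob: "y ^ q - y \<in> int_adjoin_multiples p \<beta>" if "y \<in> int_adjoin \<beta>" for y
    unfolding q_def by (rule frobenius_fixes_int_adjoin[OF p(1,2) \<beta>(2) that])
  have frob_P: "x ^ q - x \<in> P" if x: "x \<in> carrier O_K" for x
  proof -
    have "x \<in> int_adjoin_fractions \<beta>"
      using x \<beta>(1) by (intro adjoin_rat_subset_fractions) (auto simp: O_K_simps K_def)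
    then obtain d0 where d0: "d0 > 0" "of_nat d0 * x \<in> int_adjoin \<beta>"
      by (auto simp: int_adjoin_fractions_def)
    have integral: "algebraic_int (of_nat d * x)" for d
      using O_closed(2)[OF nat_O x, of d] by (simp add: O_K_simps)
    have saturated: "z \<in> int_adjoin \<beta>" if "algebraic_int z" "of_nat p * z \<in> int_adjoin \<beta>" for z
      using algebraic_int_in_int_adjoin[OF _ q2 frob that] p2 by simp
    from coprime_denominator[OF p(1) saturated integral d0]
    obtain d where d: "\<not> p dvd d" "of_nat d * x \<in> int_adjoin \<beta>" by blast
    obtain b c where b: "b \<in> int_adjoin \<beta>" "(of_nat d * x) ^ q - of_nat d * x = of_nat p * b"
      and c: "c \<in> int_adjoin \<beta>" "of_nat d ^ q - of_nat d = of_nat p * c"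
      using frob[OF d(2)] frob[OF int_adjoin_of_nat[of d]] by (auto simp: int_adjoin_multiples_def)
    have "of_nat d * (x ^ q - x) = ((of_nat d * x) ^ q - of_nat d * x) - (of_nat d ^ q - of_nat d) * x ^ q"
      by (simp add: power_mult_distrib algebra_simps)
    also have "\<dots> = of_nat p * (b - c * x ^ q)"
      unfolding b(2) c(2) by (simp add: algebra_simps)
    also have "\<dots> \<in> P"
      using I_r_closed[of "of_nat p" "b - c * x ^ q"] nat_P[of p] b(1) c(1) x
      by (simp add: O_K_simps(3) B_O O_closed)
    finally have "of_nat d \<in> P \<or> x ^ q - x \<in> P"
      using x by (intro I_prime) (simp_all add: O_K_simps(3) nat_O O_closed)
    with d(1) show ?thesis by (simp add: nat_P)
  qed
  let ?F = "O_K Quot P"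
  interpret F: domain ?F by (rule quotient_is_domain)
  interpret \<pi>: ring_hom_ring O_K ?F "(+>\<^bsub>O_K\<^esub>) P" by (rule rcos_ring_hom_ring)
  have coset_eq: "P +>\<^bsub>O_K\<^esub> x = P +>\<^bsub>O_K\<^esub> y \<longleftrightarrow> x - y \<in> P" if "x \<in> carrier O_K" "y \<in> carrier O_K" for x y
    using that quotient_eq_iff_same_a_r_cos[OF is_ideal, of x y]
    by (simp add: a_minus_def O_uminus O_K_simps(2))
  have int_O: "of_int z \<in> carrier O_K" for z by (intro B_O int_adjoin_of_int)
  have field_eq: "residue_prime_field K P = range (\<lambda>z. P +>\<^bsub>O_K\<^esub> of_int z)"
    by (simp add: residue_prime_field_def O_K_def)
  have "subring (residue_prime_field K P) ?F"
  proof (rule F.subringI)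
    show "residue_prime_field K P \<subseteq> carrier ?F"
      using \<pi>.hom_closed int_O by (auto simp: field_eq)
    show "\<one>\<^bsub>?F\<^esub> \<in> residue_prime_field K P"
      using \<pi>.hom_one unfolding field_eq by (intro range_eqI[of _ _ 1]) (simp add: O_K_simps)
  next
    fix h1 assume "h1 \<in> residue_prime_field K P"
    then obtain z where z: "h1 = P +>\<^bsub>O_K\<^esub> of_int z" by (auto simp: field_eq)
    then show "\<ominus>\<^bsub>?F\<^esub> h1 \<in> residue_prime_field K P"
      using \<pi>.hom_a_inv[OF int_O[of z]] unfolding field_eq
      by (intro range_eqI[of _ _ "- z"]) (simp add: O_uminus int_O)
    fix h2 assume "h2 \<in> residue_prime_field K P"
    then obtain z' where z': "h2 = P +>\<^bsub>O_K\<^esub> of_int z'" by (auto simp: field_eq)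
    show "h1 \<otimes>\<^bsub>?F\<^esub> h2 \<in> residue_prime_field K P"
      using \<pi>.hom_mult[OF int_O[of z] int_O[of z']] unfolding field_eq z z'
      by (intro range_eqI[of _ _ "z * z'"]) (simp add: O_K_simps)
    show "h1 \<oplus>\<^bsub>?F\<^esub> h2 \<in> residue_prime_field K P"
      using \<pi>.hom_add[OF int_O[of z] int_O[of z']] unfolding field_eq z z'
      by (intro range_eqI[of _ _ "z + z'"]) (simp add: O_K_simps)
  qed
  moreover have "card (residue_prime_field K P) = p"
  proof -
    have eq: "P +>\<^bsub>O_K\<^esub> of_int y = P +>\<^bsub>O_K\<^esub> of_int z \<longleftrightarrow> [y = z] (mod int p)" for y z
      using coset_eq[OF int_O int_O, of y z] int_P[of "y - z"] by (simp add: cong_iff_dvd_diff)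
    have "residue_prime_field K P = (\<lambda>z. P +>\<^bsub>O_K\<^esub> of_int z) ` {0..<int p}"
    proof -
      have "P +>\<^bsub>O_K\<^esub> of_int z \<in> (\<lambda>z. P +>\<^bsub>O_K\<^esub> of_int z) ` {0..<int p}" for z
        using eq[of z "z mod int p"] p2 by (intro image_eqI[of _ _ "z mod int p"]) (auto simp: cong_def)
      then show ?thesis by (auto simp: field_eq)
    qed
    moreover have "inj_on (\<lambda>z. P +>\<^bsub>O_K\<^esub> of_int z) {0..<int p}"
      by (rule inj_onI) (auto simp: eq cong_def)
    ultimately show ?thesis by (simp add: card_image)
  qed
  moreover have "x [^]\<^bsub>?F\<^esub> (p ^ n) = x" if xF: "x \<in> carrier ?F" for x
  proof -
    obtain a where a: "x = P +>\<^bsub>O_K\<^esub> a" "a \<in> carrier O_K"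
      using xF unfolding carrier_FactRing by (rule imageE)
    have "x [^]\<^bsub>?F\<^esub> q = P +>\<^bsub>O_K\<^esub> (a ^ q)"
      using \<pi>.hom_nat_pow[OF a(2), of q] by (simp add: a(1) O_K_def nat_pow_ring_of_integers)
    also have "\<dots> = x"
      unfolding a(1) using coset_eq[of "a ^ q" a] frob_P[OF a(2)] O_closed(4)[OF a(2) a(2)] a(2) by blast
    finally show ?thesis by (simp add: q_def)
  qed
  ultimately show ?thesis
    using F.dimension_dvd_if_power_fixes[OF _ _ p2 dim m(2) p(3)] by blast
qed

section \<open>Non-surjectivity\<close>

theorem theorem1:
  fixes k p m n :: nat and \<zeta> :: complex
  assumes "k \<ge> 2" and "Factorial_Ring.prime (2 * k + 1)"
    and "primitive_root_of_unity (2 * k + 1) \<zeta>"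
    and "Factorial_Ring.prime p" and "p \<noteq> 2 * k + 1"
    and "inertia_degree (adjoin_rat {\<zeta> + inverse \<zeta>}) p m" and "m > 1"
    and "Legendre 2 (int p) = -1"
    and "n > 0" and "\<not> 2 dvd n" and "\<not> m dvd n"
    and "CARD('f::{field, finite}) = p ^ n"
  defines "w \<equiv> (x1 [^]\<^bsub>F2\<^esub> (2::nat)) \<otimes>\<^bsub>F2\<^esub>
      (commutator F2 (x1 [^]\<^bsub>F2\<^esub> (-2::int)) (x2 [^]\<^bsub>F2\<^esub> (-1::int))) [^]\<^bsub>F2\<^esub> k"
  shows "\<not> surjective_word_map (PSL2 :: ('f^2^2) set monoid) w"
proof (rule not_surjective_if_trace_nonzero)
  fix A B :: "'f^2^2" assume AB: "A \<in> carrier SL2" "B \<in> carrier SL2"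
  let ?N = "2 * k + 1"
  interpret group "SL2 :: ('f^2^2) monoid" by (rule group_SL2)
  define S where "S = A [^]\<^bsub>SL2\<^esub> (2::nat)"
  define T where "T = B \<otimes>\<^bsub>SL2\<^esub> inv\<^bsub>SL2\<^esub> S \<otimes>\<^bsub>SL2\<^esub> inv\<^bsub>SL2\<^esub> B"
  have ST: "S \<in> carrier SL2" "T \<in> carrier SL2" using AB by (simp_all add: S_def T_def)
  have mult: "C \<otimes>\<^bsub>SL2\<^esub> D = C ** D" for C D :: "'f^2^2" by (simp add: SL2_def)
  have "trace T = trace (inv\<^bsub>SL2\<^esub> B ** (B ** inv\<^bsub>SL2\<^esub> S))"
    unfolding T_def mult by (rule trace_mul_sym)
  also have "inv\<^bsub>SL2\<^esub> B ** (B ** inv\<^bsub>SL2\<^esub> S) = inv\<^bsub>SL2\<^esub> S"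
    using AB ST(1) by (simp flip: mult add: m_assoc[symmetric])
  also have "trace (inv\<^bsub>SL2\<^esub> S) = trace S" by (rule trace_SL2_inv[OF ST(1)])
  finally have "trace S = trace T" by simp
  have word: "trace (word_map SL2 w (A, B)) = trace S * ((- 1) ^ k * psi k (- trace (S ** T)))"
    using trace_mult_power[OF ST \<open>trace S = trace T\<close>, of k] word_map_eval[OF AB, of k]
    by (simp add: w_def S_def T_def)
  have "trace S \<noteq> 0"
  proof
    have "S = A ** A" using AB(1) by (simp add: S_def numeral_2_eq_2 flip: mult)
    then have "trace S = (trace A)\<^sup>2 - 2"
      using trace_mult_square[of "mat 1" A] AB(1)
      by (simp add: SL2_def power2_eq_square) (simp add: trace_def mat_def sum_2)
    moreover assume "trace S = 0"
    ultimately have "(trace A)\<^sup>2 = 2" by simp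
    then show False using two_nonsquare[OF assms(12,4,10,8)] by blast
  qed
  moreover have "psi k t \<noteq> 0" for t :: 'f
  proof
    assume "psi k t = 0"
    from psi_zero_imp_cong[OF assms(12,4,2,5) this]
    have q: "[p ^ n = 1] (mod ?N) \<or> [p ^ n + 1 = 0] (mod ?N)" .
    have \<zeta>: "\<zeta> ^ ?N = 1" "\<zeta> \<noteq> 1"
      using assms(1,3) unfolding primitive_root_of_unity_def by (auto dest: spec[of _ 1])
    then have "\<zeta> \<noteq> 0" by auto
    then have "psi k (\<zeta> + inverse \<zeta>) = 0"
      using psi_closed_form[of \<zeta> k] \<zeta> by simp
    then have "algebraic_int (\<zeta> + inverse \<zeta>)" by (rule algebraic_int_psi_root)
    have "p \<noteq> 2" using assms(8) by (auto simp: Legendre_def cong_0_iff split: if_splits)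
    then have odd: "odd (p ^ n)" using primes_dvd_imp_eq[OF two_is_prime_nat assms(4)] by auto
    have "m dvd n"
      using inertia_degree_dvd[OF assms(4) odd assms(9) \<open>algebraic_int (\<zeta> + inverse \<zeta>)\<close>
          frobenius_fixes_cyclotomic_trace[OF assms(4) odd \<zeta>(1) _ q] assms(6)] assms(7) by simp
    then show False using assms(11) by simp
  qed
  ultimately show "trace (word_map SL2 w (A, B)) \<noteq> 0" unfolding word by simp
qed

end
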